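(* Consider the perturbed open quantum system $\mathrm{d}X=(AX+Z)\,\mathrm{d}t+B\,\mathrm{d}W$, $Z=i[H_1,X]$, described in the context, and suppose the matrix $A=2\Theta R-\frac12 BJB^{\mathrm T}\Theta^{-1}\in\mathbb{R}^{n\times n}$ is Hurwitz. For a positive integer $d$, a real $\mu_1>0$ and matrices $\Gamma_1,\dots,\Gamma_d\in\mathbb{R}^{n\times n}$, put $\Gamma_0:=\sqrt{\mu_1}\,I_n$, and let $\mathcal{P}$ be the set of all tuples $(\mu_1,\Gamma_1,\dots,\Gamma_d)\in\mathbb{R}\times(\mathbb{R}^{n\times n})^d$, with $d>0$ and $\mu_1>0$, for which there exist a real symmetric matrix $\Pi\succ0$ of order $n$ and a real $\gamma>0$ such that $$A^{\mathrm T}\Pi+\Pi A+\sum_{k=0}^d\Gamma_k^{\mathrm T}\Pi\Gamma_k+\gamma\Pi\preccurlyeq0 .$$ Then $\mathcal{P}$ is nonempty. Furthermore, let $\mathcal{U}$ be the set of all perturbation Hamiltonians $H_1=\int_{\mathbb{R}^n}h(\lambda)\mathrm{e}^{i\lambda^{\mathrm T}X}\,\mathrm{d}\lambda$ in Weyl quantization form whose associated vector $Z=i[H_1,X]$ satisfies the operator inequality $$ZZ^{\mathrm T}\preccurlyeq\mu_1\sum_{k=1}^d\Gamma_kXX^{\mathrm T}\Gamma_k^{\mathrm T}+\mu_0I_n$$ (in the sense of superpositiveness) for some $(\mu_1,\Gamma_1,\dots,\Gamma_d)\in\mathcal{P}$ and some $\mu_0\in\mathbb{R}$. Then the perturbed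 quantum system is mean square stable for every $H_1\in\mathcal{U}$.
   Context: System. $X=(X_1,\dots,X_n)^{\mathrm T}$ is a vector of self-adjoint operators (system variables) on a Hilbert space satisfying the canonical commutation relations $[X,X^{\mathrm T}]=2i\Theta$, i.e. $[X_j,X_k]=2i\Theta_{jk}$, where $\Theta$ is a real antisymmetric nonsingular matrix of order $n$. The system variables evolve in time (Heisenberg picture) according to the quantum stochastic differential equation (QSDE) $$\mathrm{d}X=\Big(i[H,X]-\tfrac12BJB^{\mathrm T}\Theta^{-1}X\Big)\mathrm{d}t+B\,\mathrm{d}W,$$ where $W$ is a vector of quantum Wiener processes $W_1,\dots,W_m$ on a boson Fock space with It\^o table $\mathrm{d}W\,\mathrm{d}W^{\mathrm T}=\Omega\,\mathrm{d}t$, $\Omega=I_m+iJ\succcurlyeq0$, $J$ real antisymmetric, and $B=2\Theta M^{\mathrm T}\in\mathbb{R}^{n\times m}$ with $M\in\mathbb{R}^{m\times n}$ the matrix of the linear system-field coupling. The Hamiltonian is $H=H_0+H_1$ with $H_0=\frac12X^{\mathrm T}RX$, $R$ real symmetric of order $n$. The QSDE then takes the form $\mathrm{d}X=(AX+Z)\mathrm{d}t+B\,\mathrm{d}W$ with $Z:=i[H_1,X]$ (a vector of self-adjoint operators, entries $i[H_1,X_j]$) and $A:=2\Theta R-\frac12BJB^{\mathrm T}\Theta^{-1}$. The commutation relations are preserved in time. Perturbation. $H_1=\int_{\mathbb{R}^n}h(\lambda)\mathrm{e}^{i\lambda^{\mathrm T}X}\mathrm{d}\lambda$ is the Weyl quantization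 of a real-valued function $H_1(x)$ on $\mathbb{R}^n$, where $h(\lambda)=(2\pi)^{-n}\int_{\mathbb{R}^n}H_1(x)\mathrm{e}^{-i\lambda^{\mathrm T}x}\mathrm{d}x$ is its (possibly generalized) Fourier transform; $h(-\lambda)=\overline{h(\lambda)}$, so that the operator $H_1$ is self-adjoint. Superpositiveness. The transpose acts on matrices of operators as if the entries were scalars. An $r\times r$ matrix $L=(L_{jk})$ of operators with $L_{kj}^\dagger=L_{jk}$ is superpositive, $L\succcurlyeq0$, if $\sum_{j,k}\overline{u_j}u_kL_{jk}$ is a positive semidefinite operator for every $u\in\mathbb{C}^r$; $L\preccurlyeq N$ means $N-L\succcurlyeq0$. For ordinary matrices, $\succ,\succcurlyeq$ are the usual positive (semi-)definiteness. Expectation. $\mathbf{E}\xi=\mathrm{Tr}(\rho\xi)$ with $\rho=\varpi\otimes\upsilon$, $\varpi$ the initial system state and $\upsilon$ the vacuum state of the fields. Mean square stability means that there exist constants $c_1,c_2>0$ and $c_3\ge0$ such that $\mathbf{E}(X(t)^{\mathrm T}X(t))\le c_1\mathrm{e}^{-c_2t}\,\mathbf{E}(X(0)^{\mathrm T}X(0))+c_3$ for all $t\ge0$. Domain and regularity questions for unbounded operators are not treated: all operator products, commutators, integrals and second-order expectations (including the initial second moments) are assumed well defined and finite, and the usual rules of quantum It\^o calculus apply. *)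

theory Defs
  imports "HOL-Analysis.Analysis"
begin

section \<open>Complex Hilbert spaces\<close>

text \<open>Norm, topology and completeness are those of the library's real Hilbert spaces. The inner
  product \<open>cinner\<close> is conjugate-linear in its first argument.\<close>

class complex_hilbert_space = real_inner + complete_space +
  fixes scaleC :: "complex \<Rightarrow> 'a \<Rightarrow> 'a" (infixr "*\<^sub>C" 75)
    and cinner :: "'a \<Rightarrow> 'a \<Rightarrow> complex"
  assumes scaleC_add_right: "a *\<^sub>C (x + y) = a *\<^sub>C x + a *\<^sub>C y"
    and scaleC_add_left: "(a + b) *\<^sub>C x = a *\<^sub>C x + b *\<^sub>C x"
    and scaleC_scaleC: "a *\<^sub>C b *\<^sub>C x = (a * b) *\<^sub>C x"
    and scaleR_scaleC: "r *\<^sub>R x = complex_of_real r *\<^sub>C x"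
    and cinner_commute: "cinner x y = cnj (cinner y x)"
    and cinner_add_right: "cinner x (y + z) = cinner x y + cinner x z"
    and cinner_scaleC_right: "cinner x (a *\<^sub>C y) = a * cinner x y"
    and inner_eq_Re_cinner: "inner x y = Re (cinner x y)"

instantiation complex :: complex_hilbert_space
begin

definition scaleC_complex :: "complex \<Rightarrow> complex \<Rightarrow> complex" where
  "scaleC_complex a x = a * x"

definition cinner_complex :: "complex \<Rightarrow> complex \<Rightarrow> complex" where
  "cinner_complex x y = cnj x * y"

instance
  by standard
    (auto simp: scaleC_complex_def cinner_complex_def inner_complex_def algebra_simps scaleR_conv_of_real)

end

instantiation vec :: (complex_hilbert_space, finite) complex_hilbert_space
begin

definition scaleC_vec :: "complex \<Rightarrow> 'a ^ 'b \<Rightarrow> 'a ^ 'b" where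
  "scaleC_vec a x = (\<chi> i. a *\<^sub>C (x $ i))"

definition cinner_vec :: "'a ^ 'b \<Rightarrow> 'a ^ 'b \<Rightarrow> complex" where
  "cinner_vec x y = (\<Sum>i\<in>UNIV. cinner (x $ i) (y $ i))"

instance
proof
  fix x y :: "'a ^ 'b"
  show "cinner x y = cnj (cinner y x)"
    unfolding cinner_vec_def cnj_sum by (rule sum.cong) (auto intro: cinner_commute)
qed (auto simp: scaleC_vec_def cinner_vec_def vec_eq_iff scaleC_add_right scaleC_add_left
      scaleC_scaleC scaleR_scaleC cinner_add_right cinner_scaleC_right sum.distrib sum_distrib_left
      inner_vec_def inner_eq_Re_cinner)

end


section \<open>Matrices\<close>

definition psd :: "real ^ 'n ^ 'n \<Rightarrow> bool" where
  "psd N \<longleftrightarrow> transpose N = N \<and> (\<forall>x. 0 \<le> inner x (N *v x))"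

definition pos_def :: "real ^ 'n ^ 'n \<Rightarrow> bool" where
  "pos_def N \<longleftrightarrow> transpose N = N \<and> (\<forall>x. x \<noteq> 0 \<longrightarrow> 0 < inner x (N *v x))"

definition cpsd :: "complex ^ 'n ^ 'n \<Rightarrow> bool" where
  "cpsd N \<longleftrightarrow> (\<forall>j k. N $ k $ j = cnj (N $ j $ k)) \<and> (\<forall>x. cinner x (N *v x) \<in> \<real>\<^sub>\<ge>\<^sub>0)"

definition hurwitz :: "real ^ 'n ^ 'n \<Rightarrow> bool" where
  "hurwitz N \<longleftrightarrow>
     (\<forall>l v. v \<noteq> 0 \<and> (\<chi> j k. complex_of_real (N $ j $ k)) *v v = l *s v \<longrightarrow> Re l < 0)"

definition ito_table :: "real ^ 'm ^ 'm \<Rightarrow> complex ^ 'm ^ 'm" where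
  "ito_table J = (\<chi> j k. (if j = k then 1 else 0) + \<i> * complex_of_real (J $ j $ k))"

definition noise_matrix :: "real ^ 'n ^ 'n \<Rightarrow> real ^ 'n ^ 'm \<Rightarrow> real ^ 'm ^ 'n" where
  "noise_matrix \<Theta> M = 2 *\<^sub>R (\<Theta> ** transpose M)"

definition drift_matrix ::
  "real ^ 'n ^ 'n \<Rightarrow> real ^ 'n ^ 'n \<Rightarrow> real ^ 'm ^ 'm \<Rightarrow> real ^ 'n ^ 'm \<Rightarrow> real ^ 'n ^ 'n" where
  "drift_matrix \<Theta> R J M =
     2 *\<^sub>R (\<Theta> ** R)
     - (1/2) *\<^sub>R (noise_matrix \<Theta> M ** J ** transpose (noise_matrix \<Theta> M) ** matrix_inv \<Theta>)"

text \<open>A tuple \<open>(\<mu>\<^sub>1, \<Gamma>\<^sub>1, \<dots>, \<Gamma>\<^sub>d)\<close> is a pair of a number and a list of length \<open>d\<close>.\<close>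

definition admissible_params :: "real ^ 'n ^ 'n \<Rightarrow> (real \<times> (real ^ 'n ^ 'n) list) set" where
  "admissible_params A =
     {(\<mu>1, \<Gamma>s). 0 < \<mu>1 \<and> 0 < length \<Gamma>s \<and>
        (\<exists>P \<gamma>. pos_def P \<and> 0 < \<gamma> \<and>
           psd (- (transpose A ** P + P ** A
                   + (\<Sum>\<Gamma>\<leftarrow>mat (sqrt \<mu>1) # \<Gamma>s. transpose \<Gamma> ** P ** \<Gamma>)
                   + \<gamma> *\<^sub>R P)))}"


section \<open>Operators on a common invariant domain\<close>

text \<open>An unbounded operator is represented by a total function of which only the restriction to
  a fixed dense domain \<open>D\<close> matters. All products are formed on \<open>D\<close>, which the operators leave
  invariant.\<close>

definition csubspace :: "'h::complex_hilbert_space set \<Rightarrow> bool" where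
  "csubspace D \<longleftrightarrow>
     0 \<in> D \<and> (\<forall>x\<in>D. \<forall>y\<in>D. x + y \<in> D) \<and> (\<forall>a. \<forall>x\<in>D. a *\<^sub>C x \<in> D)"

definition clinear_on :: "'h::complex_hilbert_space set \<Rightarrow> ('h \<Rightarrow> 'h) \<Rightarrow> bool" where
  "clinear_on D L \<longleftrightarrow>
     (\<forall>x\<in>D. \<forall>y\<in>D. L (x + y) = L x + L y) \<and> (\<forall>a. \<forall>x\<in>D. L (a *\<^sub>C x) = a *\<^sub>C L x)"

definition operator_on :: "'h::complex_hilbert_space set \<Rightarrow> ('h \<Rightarrow> 'h) \<Rightarrow> bool" where
  "operator_on D L \<longleftrightarrow> clinear_on D L \<and> L ` D \<subseteq> D"

definition adjoint_on :: "'h::complex_hilbert_space set \<Rightarrow> ('h \<Rightarrow> 'h) \<Rightarrow> ('h \<Rightarrow> 'h) \<Rightarrow> bool" where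
  "adjoint_on D L L' \<longleftrightarrow> (\<forall>x\<in>D. \<forall>y\<in>D. cinner x (L y) = cinner (L' x) y)"

abbreviation symmetric_on :: "'h::complex_hilbert_space set \<Rightarrow> ('h \<Rightarrow> 'h) \<Rightarrow> bool" where
  "symmetric_on D L \<equiv> adjoint_on D L L"

text \<open>The closure of \<open>L\<close> restricted to \<open>D\<close> is self-adjoint (vanishing deficiency indices).\<close>

definition ess_selfadjoint_on :: "'h::complex_hilbert_space set \<Rightarrow> ('h \<Rightarrow> 'h) \<Rightarrow> bool" where
  "ess_selfadjoint_on D L \<longleftrightarrow>
     symmetric_on D L \<and>
     closure ((\<lambda>x. L x + \<i> *\<^sub>C x) ` D) = UNIV \<and> closure ((\<lambda>x. L x - \<i> *\<^sub>C x) ` D) = UNIV"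

definition unitary :: "('h::complex_hilbert_space \<Rightarrow> 'h) \<Rightarrow> bool" where
  "unitary V \<longleftrightarrow> clinear_on UNIV V \<and> surj V \<and> (\<forall>x y. cinner (V x) (V y) = cinner x y)"

definition unitary_group :: "(real \<Rightarrow> 'h::complex_hilbert_space \<Rightarrow> 'h) \<Rightarrow> bool" where
  "unitary_group G \<longleftrightarrow>
     (\<forall>s. unitary (G s)) \<and> (\<forall>s t. G (s + t) = G s \<circ> G t) \<and> (\<forall>x. continuous_on UNIV (\<lambda>s. G s x))"

text \<open>The unitary operator \<open>exp (i L)\<close>, meaningful when \<open>L\<close> is essentially self-adjoint on \<open>D\<close>: by
  Stone's theorem there is then exactly one group \<open>G\<close> as below.\<close>

definition exp_i :: "'h::complex_hilbert_space set \<Rightarrow> ('h \<Rightarrow> 'h) \<Rightarrow> 'h \<Rightarrow> 'h" where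
  "exp_i D L = (THE V. \<exists>G. unitary_group G \<and>
     (\<forall>x\<in>D. ((\<lambda>s. G s x) has_vector_derivative \<i> *\<^sub>C L x) (at 0)) \<and> V = G 1)"

definition i_commutator :: "('h::complex_hilbert_space \<Rightarrow> 'h) \<Rightarrow> ('h \<Rightarrow> 'h) \<Rightarrow> 'h \<Rightarrow> 'h" where
  "i_commutator K L = (\<lambda>x. \<i> *\<^sub>C (K (L x) - L (K x)))"

definition lin_comb :: "real ^ 'n \<Rightarrow> ('n \<Rightarrow> 'h::complex_hilbert_space \<Rightarrow> 'h) \<Rightarrow> 'h \<Rightarrow> 'h" where
  "lin_comb l X = (\<lambda>x. \<Sum>j\<in>UNIV. (l $ j) *\<^sub>R X j x)"

text \<open>Matrices of operators: \<open>Y Y\<^sup>T\<close>, \<open>G L G\<^sup>T\<close> for a real matrix \<open>G\<close>, and \<open>c I\<close>.\<close>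

definition op_outer :: "('n \<Rightarrow> 'h \<Rightarrow> 'h) \<Rightarrow> 'n \<Rightarrow> 'n \<Rightarrow> 'h \<Rightarrow> 'h" where
  "op_outer Y j k = Y j \<circ> Y k"

definition op_congruence ::
  "real ^ 'n ^ 'n \<Rightarrow> ('n \<Rightarrow> 'n \<Rightarrow> 'h \<Rightarrow> 'h::complex_hilbert_space) \<Rightarrow> 'n \<Rightarrow> 'n \<Rightarrow> 'h \<Rightarrow> 'h" where
  "op_congruence G L j k = (\<lambda>x. \<Sum>a\<in>UNIV. \<Sum>b\<in>UNIV. (G $ j $ a * G $ k $ b) *\<^sub>R L a b x)"

definition op_scalar :: "real \<Rightarrow> 'n \<Rightarrow> 'n \<Rightarrow> 'h \<Rightarrow> 'h::complex_hilbert_space" where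
  "op_scalar c j k = (\<lambda>x. if j = k then c *\<^sub>R x else 0)"

definition superpositive ::
  "'h set \<Rightarrow> ('n::finite \<Rightarrow> 'n \<Rightarrow> 'h \<Rightarrow> 'h::complex_hilbert_space) \<Rightarrow> bool" where
  "superpositive D L \<longleftrightarrow>
     (\<forall>j k. adjoint_on D (L k j) (L j k)) \<and>
     (\<forall>u :: complex ^ 'n. \<forall>x\<in>D.
        cinner x (\<Sum>j\<in>UNIV. \<Sum>k\<in>UNIV. (cnj (u $ j) * u $ k) *\<^sub>C L j k x) \<in> \<real>\<^sub>\<ge>\<^sub>0)"

definition superpos_le ::
  "'h set \<Rightarrow> ('n::finite \<Rightarrow> 'n \<Rightarrow> 'h \<Rightarrow> 'h::complex_hilbert_space) \<Rightarrow> ('n \<Rightarrow> 'n \<Rightarrow> 'h \<Rightarrow> 'h) \<Rightarrow> bool" where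
  "superpos_le D L N \<longleftrightarrow> superpositive D (\<lambda>j k x. N j k x - L j k x)"

definition system_variables ::
  "'h::complex_hilbert_space set \<Rightarrow> real ^ 'n ^ 'n \<Rightarrow> ('n \<Rightarrow> 'h \<Rightarrow> 'h) \<Rightarrow> bool" where
  "system_variables D \<Theta> X \<longleftrightarrow>
     csubspace D \<and> closure D = UNIV \<and>
     (\<forall>j. operator_on D (X j)) \<and>
     (\<forall>l. ess_selfadjoint_on D (lin_comb l X)) \<and>
     (\<forall>j k. \<forall>x\<in>D. X j (X k x) - X k (X j x) = (2 * \<i> * complex_of_real (\<Theta> $ j $ k)) *\<^sub>C x)"


section \<open>Weyl quantization\<close>

text \<open>The Fourier transform \<open>h\<close> of a real function \<open>a\<close> on \<open>\<real>\<^sup>n\<close> is taken in the generalized sense,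
  as the functional sending a test function \<open>f\<close> to the value written \<open>\<integral> h(l) f(l) dl\<close>; the
  transform is moved to the test function. A function \<open>h\<close> in the ordinary
  sense acts on test functions by integration.\<close>

definition fourier_integral :: "(real ^ 'n \<Rightarrow> complex) \<Rightarrow> real ^ 'n \<Rightarrow> complex" where
  "fourier_integral f x = (LINT l|lborel. f l * exp (- (\<i> * complex_of_real (inner l x))))"

definition gen_fourier :: "(real ^ 'n \<Rightarrow> real) \<Rightarrow> (real ^ 'n \<Rightarrow> complex) \<Rightarrow> complex" where
  "gen_fourier a f =
     (LINT x|lborel. complex_of_real (a x) * fourier_integral f x) / of_real ((2 * pi) ^ CARD('n))"

definition gen_fourier_defined :: "(real ^ 'n \<Rightarrow> real) \<Rightarrow> (real ^ 'n \<Rightarrow> complex) \<Rightarrow> bool" where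
  "gen_fourier_defined a f \<longleftrightarrow>
     integrable lborel f \<and> integrable lborel (\<lambda>x. complex_of_real (a x) * fourier_integral f x)"

text \<open>\<open>H = \<integral> h(l) exp (i l\<^sup>T X) dl\<close> in the sense of matrix elements on \<open>D\<close>. On a domain
  invariant under the \<open>X j\<close>, the canonical commutation relations with nonsingular \<open>\<Theta>\<close> make
  the matrix elements of \<open>exp (i l\<^sup>T X)\<close> rapidly decreasing functions of \<open>l\<close>.\<close>

definition weyl_quantization ::
  "'h::complex_hilbert_space set \<Rightarrow> ('n \<Rightarrow> 'h \<Rightarrow> 'h) \<Rightarrow> (real ^ 'n \<Rightarrow> real) \<Rightarrow> ('h \<Rightarrow> 'h) \<Rightarrow> bool" where
  "weyl_quantization D X a H \<longleftrightarrow>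
     operator_on D H \<and> symmetric_on D H \<and>
     (\<forall>x\<in>D. \<forall>y\<in>D.
        gen_fourier_defined a (\<lambda>l. cinner x (exp_i D (lin_comb l X) y)) \<and>
        cinner x (H y) = gen_fourier a (\<lambda>l. cinner x (exp_i D (lin_comb l X) y)))"

definition perturbation_vector ::
  "('n \<Rightarrow> 'h \<Rightarrow> 'h::complex_hilbert_space) \<Rightarrow> ('h \<Rightarrow> 'h) \<Rightarrow> 'n \<Rightarrow> 'h \<Rightarrow> 'h" where
  "perturbation_vector X H j = i_commutator H (X j)"

definition perturbation_class ::
  "'h::complex_hilbert_space set \<Rightarrow> real ^ 'n ^ 'n \<Rightarrow> ('n \<Rightarrow> 'h \<Rightarrow> 'h) \<Rightarrow> ('h \<Rightarrow> 'h) set" where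
  "perturbation_class D A X =
     {H. (\<exists>a. weyl_quantization D X a H) \<and>
         (\<exists>(\<mu>1, \<Gamma>s) \<in> admissible_params A. \<exists>\<mu>0 :: real.
            superpos_le D (op_outer (perturbation_vector X H))
              (\<lambda>j k x. \<mu>1 *\<^sub>R (\<Sum>\<Gamma>\<leftarrow>\<Gamma>s. op_congruence \<Gamma> (op_outer X) j k x)
                       + op_scalar \<mu>0 j k x))}"


section \<open>Boson Fock space and quantum Wiener processes\<close>

definition square_integrable :: "(real \<Rightarrow> complex ^ 'r) \<Rightarrow> bool" where
  "square_integrable f \<longleftrightarrow>
     f \<in> borel_measurable lborel \<and> set_integrable lborel {0..} (\<lambda>s. (norm (f s))\<^sup>2)"

definition restr :: "real \<Rightarrow> (real \<Rightarrow> complex ^ 'r) \<Rightarrow> real \<Rightarrow> complex ^ 'r" where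
  "restr t f = (\<lambda>s. indicator {0..t} s *\<^sub>R f s)"

text \<open>The Hilbert space \<open>'h\<close> is the tensor product of the initial space \<open>'s\<close> and the boson Fock
  space over \<open>L\<^sup>2([0,\<infinity>), \<complex>\<^sup>r)\<close>: \<open>e u f\<close> stands for the product of \<open>u\<close> and the exponential
  vector of \<open>f\<close>, and the two properties determine \<open>('h, e)\<close> up to a unique unitary
  isomorphism. They imply that \<open>e\<close> is complex linear in \<open>u\<close>, so that the real span
  below is also the complex one.\<close>

definition fock_tensor ::
  "('s::complex_hilbert_space \<Rightarrow> (real \<Rightarrow> complex ^ 'r) \<Rightarrow> 'h::complex_hilbert_space) \<Rightarrow> bool" where
  "fock_tensor e \<longleftrightarrow>
     (\<forall>u v f g. square_integrable f \<longrightarrow> square_integrable g \<longrightarrow>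
        cinner (e u f) (e v g) = cinner u v * exp (LINT s:{0..}|lborel. cinner (f s) (g s))) \<and>
     closure (span {e u f | u f. square_integrable f}) = UNIV"

text \<open>\<open>V\<close> acts as the identity on the part of the Fock space which belongs to the times after \<open>t\<close>.\<close>

definition adapted ::
  "('s::complex_hilbert_space \<Rightarrow> (real \<Rightarrow> complex ^ 'r) \<Rightarrow> 'h::complex_hilbert_space)
     \<Rightarrow> real \<Rightarrow> ('h \<Rightarrow> 'h) \<Rightarrow> bool" where
  "adapted e t V \<longleftrightarrow>
     (\<forall>u v f g. square_integrable f \<longrightarrow> square_integrable g \<longrightarrow>
        cinner (e u f) (V (e v g)) =
        cinner (e u (restr t f)) (V (e v (restr t g))) * exp (LINT s:{t..}|lborel. cinner (f s) (g s)))"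

text \<open>The operators \<open>X j\<close> act on the initial space only; \<open>D\<close> is large enough.\<close>

definition acts_on_system ::
  "('s::complex_hilbert_space \<Rightarrow> (real \<Rightarrow> complex ^ 'r) \<Rightarrow> 'h::complex_hilbert_space)
     \<Rightarrow> 'h set \<Rightarrow> ('n \<Rightarrow> 'h \<Rightarrow> 'h) \<Rightarrow> bool" where
  "acts_on_system e D X \<longleftrightarrow>
     (\<exists>D0 X0. csubspace D0 \<and> closure D0 = UNIV \<and> (\<forall>j. operator_on D0 (X0 j)) \<and>
        (\<forall>j. \<forall>u\<in>D0. \<forall>f. square_integrable f \<longrightarrow> e u f \<in> D \<and> X j (e u f) = e (X0 j u) f))"

text \<open>\<open>W t k\<close> is the sum of the annihilation and creation operators of the function \<open>c k\<close> on \<open>[0,t]\<close>,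
  given by its matrix elements between exponential vectors. The quantum Ito table
  \<open>dW\<^sub>j dW\<^sub>k = (c\<^sub>j, c\<^sub>k) dt\<close> of these processes is the Gram matrix of the vectors \<open>c\<close>.\<close>

definition wiener_processes ::
  "('s::complex_hilbert_space \<Rightarrow> (real \<Rightarrow> complex ^ 'r) \<Rightarrow> 'h::complex_hilbert_space)
     \<Rightarrow> 'h set \<Rightarrow> real ^ 'm ^ 'm \<Rightarrow> (real \<Rightarrow> 'm \<Rightarrow> 'h \<Rightarrow> 'h) \<Rightarrow> bool" where
  "wiener_processes e D J W \<longleftrightarrow>
     (\<exists>c :: 'm \<Rightarrow> complex ^ 'r.
        (\<forall>j k. cinner (c j) (c k) = ito_table J $ j $ k) \<and>
        (\<forall>t\<ge>0. \<forall>k. operator_on D (W t k) \<and> symmetric_on D (W t k) \<and>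
           (\<forall>u v f g. square_integrable f \<longrightarrow> square_integrable g \<longrightarrow> e v g \<in> D \<longrightarrow>
              cinner (e u f) (W t k (e v g)) =
              ((LINT s:{0..t}|lborel. cinner (c k) (g s)) + (LINT s:{0..t}|lborel. cinner (f s) (c k)))
              * cinner (e u f) (e v g))))"


section \<open>Dynamics, expectation and stability\<close>

definition heis :: "(real \<Rightarrow> 'h \<Rightarrow> 'h) \<Rightarrow> real \<Rightarrow> ('h \<Rightarrow> 'h) \<Rightarrow> 'h \<Rightarrow> 'h" where
  "heis U t L = inv (U t) \<circ> L \<circ> U t"

text \<open>\<open>U\<close> is the adapted unitary evolution of system and fields, \<open>X(t) = U(t)\<^sup>* X U(t)\<close>, and the QSDE
  \<open>dX = (A X + Z) dt + B dW\<close> with \<open>Z = i [H, X]\<close> holds in integrated form on \<open>D\<close>; since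
  \<open>B\<close> is constant, the integral of \<open>B dW\<close> over \<open>[0,t]\<close> is \<open>B W(t)\<close>.\<close>

definition perturbed_evolution ::
  "('s::complex_hilbert_space \<Rightarrow> (real \<Rightarrow> complex ^ 'r) \<Rightarrow> 'h::complex_hilbert_space)
     \<Rightarrow> 'h set \<Rightarrow> real ^ 'n ^ 'n \<Rightarrow> real ^ 'm ^ 'n \<Rightarrow> ('n \<Rightarrow> 'h \<Rightarrow> 'h) \<Rightarrow> (real \<Rightarrow> 'm \<Rightarrow> 'h \<Rightarrow> 'h)
     \<Rightarrow> ('h \<Rightarrow> 'h) \<Rightarrow> (real \<Rightarrow> 'h \<Rightarrow> 'h) \<Rightarrow> bool" where
  "perturbed_evolution e D A B X W H U \<longleftrightarrow>
     U 0 = id \<and>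
     (\<forall>t\<ge>0. unitary (U t) \<and> adapted e t (U t) \<and> U t ` D = D) \<and>
     (\<forall>t\<ge>0. \<forall>j. \<forall>x\<in>D.
        ((\<lambda>s. (\<Sum>k\<in>UNIV. (A $ j $ k) *\<^sub>R heis U s (X k) x)
              + i_commutator (heis U s H) (heis U s (X j)) x)
         has_integral
         (heis U t (X j) x - heis U 0 (X j) x - (\<Sum>k\<in>UNIV. (B $ j $ k) *\<^sub>R W t k x))) {0..t})"

text \<open>The initial system state is the density operator with eigenvalues \<open>p i\<close> and eigenvectors \<open>u i\<close>,
  and \<open>e (u i) 0\<close> is the product of \<open>u i\<close> and the vacuum vector.\<close>

definition initial_state ::
  "('s::complex_hilbert_space \<Rightarrow> (real \<Rightarrow> complex ^ 'r) \<Rightarrow> 'h::complex_hilbert_space)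
     \<Rightarrow> 'h set \<Rightarrow> (nat \<Rightarrow> real) \<Rightarrow> (nat \<Rightarrow> 's) \<Rightarrow> bool" where
  "initial_state e D p u \<longleftrightarrow>
     (\<forall>i. 0 \<le> p i) \<and> p sums 1 \<and>
     (\<forall>i j. p i \<noteq> 0 \<longrightarrow> p j \<noteq> 0 \<longrightarrow> cinner (u i) (u j) = (if i = j then 1 else 0)) \<and>
     (\<forall>i. p i \<noteq> 0 \<longrightarrow> e (u i) (\<lambda>_. 0) \<in> D)"

definition expectation_term ::
  "('s::complex_hilbert_space \<Rightarrow> (real \<Rightarrow> complex ^ 'r) \<Rightarrow> 'h::complex_hilbert_space)
     \<Rightarrow> (nat \<Rightarrow> real) \<Rightarrow> (nat \<Rightarrow> 's) \<Rightarrow> ('h \<Rightarrow> 'h) \<Rightarrow> nat \<Rightarrow> complex" where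
  "expectation_term e p u L i = of_real (p i) * cinner (e (u i) (\<lambda>_. 0)) (L (e (u i) (\<lambda>_. 0)))"

definition has_expectation ::
  "('s::complex_hilbert_space \<Rightarrow> (real \<Rightarrow> complex ^ 'r) \<Rightarrow> 'h::complex_hilbert_space)
     \<Rightarrow> (nat \<Rightarrow> real) \<Rightarrow> (nat \<Rightarrow> 's) \<Rightarrow> ('h \<Rightarrow> 'h) \<Rightarrow> bool" where
  "has_expectation e p u L \<longleftrightarrow> summable (\<lambda>i. norm (expectation_term e p u L i))"

definition expectation ::
  "('s::complex_hilbert_space \<Rightarrow> (real \<Rightarrow> complex ^ 'r) \<Rightarrow> 'h::complex_hilbert_space)
     \<Rightarrow> (nat \<Rightarrow> real) \<Rightarrow> (nat \<Rightarrow> 's) \<Rightarrow> ('h \<Rightarrow> 'h) \<Rightarrow> complex" where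
  "expectation e p u L = (\<Sum>i. expectation_term e p u L i)"

text \<open>\<open>X(t)\<^sup>T X(t)\<close>\<close>

definition square_sum ::
  "('n::finite \<Rightarrow> 'h \<Rightarrow> 'h::complex_hilbert_space) \<Rightarrow> (real \<Rightarrow> 'h \<Rightarrow> 'h) \<Rightarrow> real \<Rightarrow> 'h \<Rightarrow> 'h" where
  "square_sum X U t = (\<lambda>x. \<Sum>j\<in>UNIV. heis U t (X j) (heis U t (X j) x))"

text \<open>The constants do not depend on the initial state. For a single fixed state,
  the estimate would merely say that the second moments are bounded in time.\<close>

definition mean_square_stable ::
  "('s::complex_hilbert_space \<Rightarrow> (real \<Rightarrow> complex ^ 'r) \<Rightarrow> 'h::complex_hilbert_space)
     \<Rightarrow> 'h set \<Rightarrow> ('n::finite \<Rightarrow> 'h \<Rightarrow> 'h) \<Rightarrow> (real \<Rightarrow> 'h \<Rightarrow> 'h) \<Rightarrow> bool" where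
  "mean_square_stable e D X U \<longleftrightarrow>
     (\<exists>c1 c2 c3 :: real. 0 < c1 \<and> 0 < c2 \<and> 0 \<le> c3 \<and>
        (\<forall>p u. initial_state e D p u \<longrightarrow> has_expectation e p u (square_sum X U 0) \<longrightarrow>
           (\<forall>t\<ge>0. has_expectation e p u (square_sum X U t) \<and>
              Re (expectation e p u (square_sum X U t))
              \<le> c1 * exp (- c2 * t) * Re (expectation e p u (square_sum X U 0)) + c3)))"

end

theory Submission
  imports Defs "HOL-Computational_Algebra.Fundamental_Theorem_Algebra"
begin

text \<open>Some \<open>\<Pi> \<succ> 0\<close> satisfies \<open>A\<^sup>T \<Pi> + \<Pi> A + \<delta> \<Pi> \<preceq> 0\<close> by Lyapunov's theorem, so \<open>d = 1\<close>, \<open>\<Gamma>\<^sub>1 = 0\<close>,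
  \<open>\<mu>\<^sub>1 = \<gamma> = \<delta> / 2\<close> are admissible parameters.

  For the stability, write \<open>\<Pi> = Q\<^sup>T Q\<close> and apply the processes to a vector \<open>\<psi>\<close> (an initial vector
  times the vacuum): \<open>a(t) = Q X(t) \<psi>\<close> is a Hilbert space valued process with drift
  \<open>Q (A X + Z) \<psi>\<close> and noise \<open>Q B W(t) \<psi>\<close>. It is adapted, and the increments of \<open>W \<psi>\<close> after time \<open>s\<close> are
  orthogonal to all vectors adapted at \<open>s\<close> and have squared norm of the order of the time step.
  Superpositiveness bounds \<open>\<parallel>Q Z \<psi>\<parallel>\<^sup>2\<close>; with the matrix inequality the upper Dini derivative of
  \<open>V = \<parallel>a\<parallel>\<^sup>2\<close> is at most \<open>C - \<gamma> V\<close>, where \<open>C\<close> does not depend on the initial vector. Comparison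
  gives the exponential bound for each \<open>\<psi>\<close>, and averaging over the eigenvectors of the initial
  state gives the claim.\<close>

section \<open>The Lyapunov inequality for Hurwitz matrices\<close>

text \<open>The noise increment over a step \<open>h\<close> has norm of order
  \<open>sqrt h\<close>, and the drift of \<open>a\<close> is only known to grow at most linearly,
  not to be continuous in time. So \<open>V\<close> is not differentiated; its increment over a
  short step is expanded directly. The product of the drift increment with the noise over the same
  step need not vanish; it is absorbed by doubling the noise constant, which enlarges the additive
  constant but leaves the decay rate \<gamma> intact.

  Adaptedness has to be carried through \<open>U t\<close>, the unbounded \<open>X j\<close> and
  \<open>inv (U t)\<close>. Conditions on inner products with exponential vectors survive all three,
  and an orthogonal projection turns them into membership in a closed span when orthogonality to the
  noise is needed.

  The operator inequality for \<open>Z\<close> is given for the initial operators. It serves all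
  times because it can be evaluated at \<open>U t \<psi>\<close>, which stays in \<open>D\<close>,
  and \<open>inv (U t)\<close> is an isometry. Unit initial vectors make the term with
  \<open>\<mu>0\<close>, and hence all constants, independent of the state.\<close>

definition shift_mult :: "complex ^ 'n ^ 'n \<Rightarrow> complex \<Rightarrow> complex ^ 'n \<Rightarrow> complex ^ 'n" where
  "shift_mult N l v = N *v v - l *s v"

fun shift_prod :: "complex ^ 'n ^ 'n \<Rightarrow> complex list \<Rightarrow> complex ^ 'n \<Rightarrow> complex ^ 'n" where
  "shift_prod N [] v = v"
| "shift_prod N (l # ls) v = shift_prod N ls (shift_mult N l v)"

lemma of_real_scalar_mult_eq_scaleR: "complex_of_real r *s w = r *\<^sub>R w"
  by (simp add: vec_eq_iff scaleR_conv_of_real[where 'a = complex])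

lemma linear_shift_mult: "linear (shift_mult N l)"
  unfolding shift_mult_def
  by (rule linearI) (simp_all add: matrix_vector_right_distrib algebra_simps vec_eq_iff
    matrix_vector_mult_def sum.distrib sum_distrib_left scaleR_sum_right)

lemma linear_shift_prod: "linear (shift_prod N ls)"
proof (induction ls)
  case Nil
  show ?case by (rule linearI) auto
next
  case (Cons l ls)
  have "shift_prod N (l # ls) = shift_prod N ls \<circ> shift_mult N l"
    by (auto simp: fun_eq_iff)
  then show ?case
    using linear_compose[OF linear_shift_mult Cons.IH] by metis
qed

lemma shift_mult_commute: "shift_mult N l (shift_mult N k v) = shift_mult N k (shift_mult N l v)"
proof -
  have "N *v (c *s w) = c *s (N *v w)" for c w
    by (simp add: vector_scalar_commute)
  then show ?thesis
    unfolding shift_mult_def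
    by (simp add: matrix_vector_mult_diff_distrib vec_eq_iff algebra_simps)
qed

lemma shift_prod_commute:
  "shift_prod N ls (shift_mult N l v) = shift_mult N l (shift_prod N ls v)"
proof (induction ls arbitrary: v)
  case (Cons k ls)
  then show ?case by (metis shift_mult_commute shift_prod.simps(2))
qed simp

lemma shift_prod_append: "shift_prod N (ls @ ks) v = shift_prod N ks (shift_prod N ls v)"
  by (induction ls arbitrary: v) simp_all

lemma shift_prod_swap:
  "shift_prod N ls (shift_prod N ks v) = shift_prod N ks (shift_prod N ls v)"
  by (induction ks arbitrary: v) (simp_all add: shift_prod_commute)

section \<open>Annihilating products of shifted matrices\<close>

text \<open>Over the complex numbers \<open>p\<close> splits: if \<open>p = [:-z, 1:] * q\<close>,
  then \<open>q\<close> applied to \<open>N\<close> kills \<open>shift_mult N z v\<close>, and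
  induction on the degree peels off the remaining roots.\<close>

lemma poly_annihilation_imp_shift_prod:
  fixes N :: "complex ^ 'n ^ 'n"
  assumes "p \<noteq> 0"
    and "(\<Sum>i\<le>degree p. coeff p i *s (((*v) N) ^^ i) v) = 0"
  shows "\<exists>ls. shift_prod N ls v = 0"
  using assms
proof (induction "degree p" arbitrary: p v rule: less_induct)
  case less
  show ?case
  proof (cases "degree p = 0")
    case True
    then have "coeff p 0 \<noteq> 0"
      using less.prems(1) leading_coeff_0_iff[of p] by auto
    moreover have "coeff p 0 *s v = 0"
      using less.prems(2) True by simp
    ultimately have "v = 0" by (simp add: vec_eq_iff)
    then have "shift_prod N [] v = 0" by simp
    then show ?thesis by blast
  next
    case False
    then have "\<not> constant (poly p)" by (simp add: constant_degree)
    then obtain z where "poly p z = 0"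
      using fundamental_theorem_of_algebra by blast
    then obtain q where q: "p = [:-z, 1:] * q"
      by (metis poly_eq_0_iff_dvd dvdE)
    have q0: "q \<noteq> 0" using q less.prems(1) by auto
    have deg: "degree p = Suc (degree q)"
      using degree_mult_eq[of "[:-z, 1:]" q] q0 unfolding q by simp
    define T where "T = (*v) N"
    have coeff_p: "coeff p i = (case i of 0 \<Rightarrow> 0 | Suc j \<Rightarrow> coeff q j) - z * coeff q i" for i
      by (cases i) (simp_all add: q)
    have lin: "(T ^^ i) (shift_mult N z v) = (T ^^ Suc i) v - z *s (T ^^ i) v" for i
    proof (induction i)
      case 0
      then show ?case by (simp add: shift_mult_def T_def)
    next
      case (Suc i)
      then show ?case
        by (simp add: T_def matrix_vector_mult_diff_distrib vector_scalar_commute)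
    qed
    have "(\<Sum>i\<le>degree q. coeff q i *s (T ^^ i) (shift_mult N z v))
        = (\<Sum>i\<le>degree q. coeff q i *s (T ^^ Suc i) v)
          - (\<Sum>i\<le>degree q. (z * coeff q i) *s (T ^^ i) v)"
      unfolding lin sum_subtractf[symmetric]
      by (rule sum.cong) (simp_all add: vec_eq_iff algebra_simps)
    also have "(\<Sum>i\<le>degree q. coeff q i *s (T ^^ Suc i) v)
        = (\<Sum>i\<le>Suc (degree q). (case i of 0 \<Rightarrow> 0 | Suc j \<Rightarrow> coeff q j) *s (T ^^ i) v)"
      unfolding sum.atMost_Suc_shift by simp
    also have "(\<Sum>i\<le>degree q. (z * coeff q i) *s (T ^^ i) v)
        = (\<Sum>i\<le>Suc (degree q). (z * coeff q i) *s (T ^^ i) v)"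
      by (simp add: coeff_eq_0)
    also have "(\<Sum>i\<le>Suc (degree q). (case i of 0 \<Rightarrow> 0 | Suc j \<Rightarrow> coeff q j) *s (T ^^ i) v) - \<dots>
        = (\<Sum>i\<le>degree p. coeff p i *s (T ^^ i) v)"
      unfolding deg sum_subtractf[symmetric] coeff_p
      by (rule sum.cong) (simp_all add: vec_eq_iff algebra_simps)
    also have "\<dots> = 0" using less.prems(2) by (simp add: T_def)
    finally obtain ls where "shift_prod N ls (shift_mult N z v) = 0"
      using less.hyps[of q "shift_mult N z v"] deg q0 unfolding T_def by auto
    then have "shift_prod N (z # ls) v = 0" by simp
    then show ?thesis by blast
  qed
qed

text \<open>The vectors \<open>v\<close>, \<open>N v\<close>, \<open>N (N v)\<close> and so on
  become dependent once they outnumber the dimension, and the coefficients of a dependence form a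
  nonzero polynomial. The dimension is the real one, so these coefficients are real.\<close>

lemma ex_shift_prod_eq_0: "\<exists>ls. shift_prod N ls v = 0"
proof -
  define g where "g i = (((*v) N) ^^ i) v" for i :: nat
  define n where "n = DIM(complex ^ 'a)"
  obtain c :: "nat \<Rightarrow> real" where c: "\<exists>i\<le>n. c i \<noteq> 0" "(\<Sum>i\<le>n. c i *\<^sub>R g i) = 0"
  proof (cases "inj_on g {..n}")
    case True
    have "dependent (g ` {..n})"
      using True by (intro dependent_biggerset) (simp add: card_image n_def)
    then obtain u where u: "\<exists>w\<in>g ` {..n}. u w \<noteq> 0" "(\<Sum>w\<in>g ` {..n}. u w *\<^sub>R w) = 0"
      unfolding dependent_finite[OF finite_imageI[OF finite_atMost]] by blast
    show ?thesis
      using u by (intro that[of "u \<circ> g"]) (auto simp: sum.reindex[OF True] o_def)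
  next
    \<comment> \<open>Dependence is a property of sets, in which a repeated vector is invisible; the
      repetition itself gives the relation, with coefficients 1 and -1.\<close>
    case False
    then obtain i j where ij: "i \<le> n" "j \<le> n" "i \<noteq> j" "g i = g j"
      by (auto simp: inj_on_def)
    have "(\<Sum>k\<le>n. (if k = i then 1 else if k = j then -1 else 0 :: real) *\<^sub>R g k)
        = (\<Sum>k\<in>{i, j}. (if k = i then 1 else if k = j then -1 else 0 :: real) *\<^sub>R g k)"
      using ij by (intro sum.mono_neutral_right) auto
    also have "\<dots> = 0" using ij by simp
    finally show ?thesis
      using ij by (intro that[of "\<lambda>k. if k = i then 1 else if k = j then -1 else 0"]) auto
  qed
  define p where "p = (\<Sum>i\<le>n. monom (complex_of_real (c i)) i)"
  have coeff_p: "coeff p i = (if i \<le> n then complex_of_real (c i) else 0)" for i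
    by (simp add: p_def coeff_sum coeff_monom if_distrib cong: if_cong)
  have "p \<noteq> 0"
    using c(1) coeff_p by (metis coeff_0 of_real_eq_0_iff)
  have deg: "degree p \<le> n" by (rule degree_le) (simp add: coeff_p)
  have "(\<Sum>i\<le>degree p. coeff p i *s g i) = (\<Sum>i\<le>n. coeff p i *s g i)"
    using deg by (intro sum.mono_neutral_left) (auto simp: coeff_eq_0)
  also have "\<dots> = (\<Sum>i\<le>n. c i *\<^sub>R g i)"
    by (intro sum.cong) (simp_all add: coeff_p of_real_scalar_mult_eq_scaleR)
  finally show ?thesis
    using poly_annihilation_imp_shift_prod[OF \<open>p \<noteq> 0\<close>] c(2) unfolding g_def by auto
qed

text \<open>Lists that kill single basis vectors are concatenated. The factors commute, so the
  annihilator of any given vector may be taken to act first.\<close>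

lemma ex_shift_prod_annihilates: "\<exists>ls. \<forall>v. shift_prod N ls v = 0"
proof -
  have "\<exists>ls. \<forall>v\<in>S. shift_prod N ls v = 0" if "finite S" for S
    using that
  proof induction
    case (insert v S)
    then obtain ls where ls: "\<forall>v\<in>S. shift_prod N ls v = 0" by blast
    obtain ks where ks: "shift_prod N ks v = 0" using ex_shift_prod_eq_0 by blast
    have "shift_prod N (ls @ ks) w = 0" if "w \<in> insert v S" for w
    proof (cases "w = v")
      case True
      then show ?thesis
        by (simp add: shift_prod_append shift_prod_swap[of N ks ls] ks linear_0[OF linear_shift_prod])
    next
      case False
      then show ?thesis
        using that ls by (simp add: shift_prod_append linear_0[OF linear_shift_prod])
    qed
    then show ?case by blast
  qed auto
  then obtain ls where ls: "\<forall>v\<in>Basis. shift_prod N ls v = 0" by (meson finite_Basis)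
  have "shift_prod N ls v = 0" for v
    by (rule linear_eq_0_on_span[OF linear_shift_prod, of Basis]) (use ls in \<open>auto simp: span_Basis\<close>)
  then show ?thesis by blast
qed

text \<open>A factor \<open>N - l\<close> with \<open>l\<close> outside \<open>S\<close> is
  injective by the first hypothesis, so it can be cancelled from an annihilating product. With the
  left half plane as \<open>S\<close>, this is where the Hurwitz property enters.\<close>

lemma shift_prod_filter_eq_0:
  assumes "\<And>l w. w \<noteq> 0 \<Longrightarrow> shift_mult N l w = 0 \<Longrightarrow> S l"
    and "shift_prod N ls v = 0"
  shows "shift_prod N (filter S ls) v = 0"
  using assms(2)
proof (induction ls arbitrary: v)
  case (Cons l ls)
  then have "shift_prod N (filter S ls) (shift_mult N l v) = 0" by simp
  then show ?case
    using assms(1) by (auto simp: shift_prod_commute)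
qed auto

text \<open>On the vectors killed by \<open>(N - l\<^sub>1) \<dots> (N - l\<^sub>k)\<close> a Lyapunov form is a combination of the squared
  norms of \<open>(N - l\<^sub>1) \<dots> (N - l\<^sub>i) v\<close>, \<open>i < k\<close>, with weights chosen recursively. This avoids matrix
  exponentials and normal forms.\<close>

lemma ex_lyapunov_form:
  assumes "\<forall>l\<in>set ls. Re l < 0"
  shows "\<exists>F \<delta>. bilinear F \<and> (\<forall>v w. F v w = F w v) \<and> 0 < \<delta> \<and> (\<forall>v. 0 \<le> F v v) \<and>
    (\<forall>v. shift_prod N ls v = 0 \<longrightarrow>
       (norm v)\<^sup>2 \<le> F v v \<and> 2 * F v (N *v v) \<le> - \<delta> * F v v)"
  using assms
proof (induction ls)
  case Nil
  have "bilinear (\<lambda>v w :: complex ^ 'a. 0 :: real)"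
    by (auto simp: bilinear_def linear_iff)
  then show ?case
    by (intro exI[of _ "\<lambda>v w. 0"] exI[of _ 1]) auto
next
  case (Cons l ls)
  then obtain F \<delta> where F: "bilinear F" "\<And>v w. F v w = F w v" "0 < \<delta>" "\<And>v. 0 \<le> F v v"
    "\<And>v. shift_prod N ls v = 0 \<Longrightarrow> (norm v)\<^sup>2 \<le> F v v \<and> 2 * F v (N *v v) \<le> - \<delta> * F v v"
    by auto
  define r where "r = - Re l"
  have r: "0 < r" using Cons.prems by (simp add: r_def)
  let ?T = "shift_mult N l"
  \<comment> \<open>The weight makes \<open>\<kappa> * \<delta> / 2\<close> equal to
    \<open>1 / r\<close>: half of the decay of the old form pays for the cross term between
    \<open>v\<close> and \<open>?T v\<close>, and the other half remains as the rate
    \<open>\<delta> / 2\<close>.\<close>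
  define \<kappa> where "\<kappa> = 2 / (\<delta> * r)"
  have \<kappa>: "0 < \<kappa>" using F(3) r by (simp add: \<kappa>_def)
  define G where "G v w = inner v w + \<kappa> * F (?T v) (?T w)" for v w
  have lin1: "linear (F v)" and lin2: "linear (\<lambda>v. F v w)" for v w
    using F(1) by (auto simp: bilinear_def)
  have "bilinear G"
    unfolding bilinear_def G_def
    by (auto intro!: linearI simp: inner_simps linear_add[OF linear_shift_mult]
        linear_scale[OF linear_shift_mult] linear_add[OF lin1] linear_scale[OF lin1]
        linear_add[OF lin2] linear_scale[OF lin2] algebra_simps)
  moreover have "G v w = G w v" for v w
    by (simp add: G_def inner_commute F(2)[of "?T v"])
  moreover have "0 \<le> G v v" for v
    using F(4) \<kappa> by (simp add: G_def)
  moreover have "0 < min r (\<delta> / 2)" using r F(3) by simp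
  moreover have "(norm v)\<^sup>2 \<le> G v v \<and> 2 * G v (N *v v) \<le> - min r (\<delta> / 2) * G v v"
    if v: "shift_prod N (l # ls) v = 0" for v
  proof
    have G1: "G v v = (norm v)\<^sup>2 + \<kappa> * F (?T v) (?T v)"
      by (simp add: G_def power2_norm_eq_inner)
    show "(norm v)\<^sup>2 \<le> G v v" using F(4) \<kappa> by (simp add: G1)
    have Tv: "(norm (?T v))\<^sup>2 \<le> F (?T v) (?T v)"
      "2 * F (?T v) (N *v (?T v)) \<le> - \<delta> * F (?T v) (?T v)"
      using F(5)[of "?T v"] v by auto
    \<comment> \<open>Since \<open>?T\<close> commutes with \<open>N\<close>, the induction
      hypothesis for the vector \<open>?T v\<close> also controls the second summand of
      \<open>G v (N *v v)\<close>.\<close>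
    have TN: "?T (N *v v) = N *v (?T v)"
      by (simp add: shift_mult_def matrix_vector_mult_diff_distrib vector_scalar_commute)
    have "inner v (l *s v) = Re l * (norm v)\<^sup>2"
    proof -
      have "inner z (l * z) = Re l * inner z z" for z :: complex
        by (simp add: inner_complex_def algebra_simps)
      then show ?thesis
        by (simp add: power2_norm_eq_inner inner_vec_def sum_distrib_left)
    qed
    then have "2 * inner v (N *v v) = - 2 * r * (norm v)\<^sup>2 + 2 * inner v (?T v)"
      by (simp add: shift_mult_def inner_diff_right r_def)
    \<comment> \<open>Young's inequality with weight \<open>r\<close> uses up half of the decay
      \<open>2 * r\<close> of the norm.\<close>
    also have "2 * inner v (?T v) \<le> r * (norm v)\<^sup>2 + (norm (?T v))\<^sup>2 / r"
    proof -
      have "0 \<le> (norm (r *\<^sub>R v - ?T v))\<^sup>2" by simp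
      also have "\<dots> = r\<^sup>2 * (norm v)\<^sup>2 - 2 * r * inner v (?T v) + (norm (?T v))\<^sup>2"
        unfolding power2_norm_eq_inner inner_diff_left inner_diff_right
        by (simp add: inner_commute[of "?T v" v] power2_eq_square)
      finally have "r * (2 * inner v (?T v)) \<le> r * (r * (norm v)\<^sup>2 + (norm (?T v))\<^sup>2 / r)"
        using r by (simp add: power2_eq_square[of r] distrib_left mult.assoc)
      then show ?thesis using r by (simp only: mult_le_cancel_left_pos)
    qed
    finally have 1: "2 * inner v (N *v v) \<le> - r * (norm v)\<^sup>2 + F (?T v) (?T v) / r"
      using divide_right_mono[OF Tv(1), of r] r by simp
    have 2: "\<kappa> * (2 * F (?T v) (N *v (?T v))) \<le> \<kappa> * (- \<delta> * F (?T v) (?T v))"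
      using Tv(2) \<kappa> by (intro mult_left_mono) auto
    have 3: "F (?T v) (?T v) / r = \<kappa> * (\<delta> / 2) * F (?T v) (?T v)"
      using r F(3) by (simp add: \<kappa>_def)
    have "2 * G v (N *v v) \<le> - r * (norm v)\<^sup>2 - (\<delta> / 2) * (\<kappa> * F (?T v) (?T v))"
      using 1 2 unfolding 3 G_def TN by (simp add: algebra_simps)
    moreover have "min r (\<delta> / 2) * (norm v)\<^sup>2 \<le> r * (norm v)\<^sup>2"
      by (intro mult_right_mono) auto
    moreover have "min r (\<delta> / 2) * (\<kappa> * F (?T v) (?T v)) \<le> (\<delta> / 2) * (\<kappa> * F (?T v) (?T v))"
      using \<kappa> F(4) by (intro mult_right_mono) auto
    ultimately show "2 * G v (N *v v) \<le> - min r (\<delta> / 2) * G v v"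
      unfolding G1 by (simp add: algebra_simps)
  qed
  ultimately show ?case by blast
qed

section \<open>From the complex form to a real Lyapunov matrix\<close>

lemma hurwitz_imp_lyapunov:
  fixes A :: "real ^ 'n ^ 'n"
  assumes "hurwitz A"
  obtains P \<delta> where "pos_def P" "0 < \<delta>" "psd (- (transpose A ** P + P ** A + \<delta> *\<^sub>R P))"
proof -
  define N :: "complex ^ 'n ^ 'n" where "N = (\<chi> j k. complex_of_real (A $ j $ k))"
  obtain ls where ls: "\<And>v. shift_prod N ls v = 0"
    using ex_shift_prod_annihilates[of N] by blast
  define ks where "ks = filter (\<lambda>l. Re l < 0) ls"
  have ks: "shift_prod N ks v = 0" for v
    unfolding ks_def
  proof (rule shift_prod_filter_eq_0[OF _ ls])
    fix l w assume "w \<noteq> 0" "shift_mult N l w = 0"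
    then show "Re l < 0"
      using assms unfolding hurwitz_def N_def[symmetric] shift_mult_def by auto
  qed
  have "\<forall>l\<in>set ks. Re l < 0" by (simp add: ks_def)
  from ex_lyapunov_form[OF this, of N] ks obtain F \<delta> where
    F: "bilinear F" "\<And>v w. F v w = F w v" "0 < \<delta>"
      "\<And>v. (norm v)\<^sup>2 \<le> F v v" "\<And>v. 2 * F v (N *v v) \<le> - \<delta> * F v v"
    by auto
  define E :: "real ^ 'n \<Rightarrow> complex ^ 'n" where "E x = (\<chi> j. complex_of_real (x $ j))" for x
  have linE: "linear E"
    by (rule linearI) (simp_all add: E_def vec_eq_iff scaleR_conv_of_real[where 'a = complex])
  have EA: "E (A *v x) = N *v E x" for x
    by (simp add: E_def N_def vec_eq_iff matrix_vector_mult_def)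
  \<comment> \<open>The Gram matrix of \<open>F\<close> on the embedded unit vectors. Its entries
    are real because \<open>F\<close> is a real bilinear form on the complex space.\<close>
  define P :: "real ^ 'n ^ 'n" where "P = (\<chi> j k. F (E (axis j 1)) (E (axis k 1)))"
  have lin1: "linear (F v)" and lin2: "linear (\<lambda>v. F v w)" for v w
    using F(1) by (auto simp: bilinear_def)
  have P: "inner x (P *v y) = F (E x) (E y)" for x y
  proof -
    have ex: "E x = (\<Sum>j\<in>UNIV. (x $ j) *\<^sub>R E (axis j 1))" for x
      unfolding linear_scale[OF linE, symmetric] linear_sum[OF linE, symmetric]
      by (simp add: basis_expansion scalar_mult_eq_scaleR[symmetric])
    have "F (E x) (E y) = (\<Sum>j\<in>UNIV. x $ j * (\<Sum>k\<in>UNIV. y $ k * F (E (axis j 1)) (E (axis k 1))))"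
      unfolding ex[of x] linear_sum[OF lin2] linear_scale[OF lin2]
      unfolding ex[of y] linear_sum[OF lin1] linear_scale[OF lin1]
      by simp
    also have "\<dots> = inner x (P *v y)"
      by (simp add: P_def inner_vec_def matrix_vector_mult_def mult.commute)
    finally show ?thesis by simp
  qed
  have symP: "transpose P = P"
    by (simp add: P_def transpose_def vec_eq_iff F(2))
  have "pos_def P"
    unfolding pos_def_def
  proof (intro conjI allI impI symP)
    fix x :: "real ^ 'n" assume "x \<noteq> 0"
    then have "E x \<noteq> 0" by (auto simp: E_def vec_eq_iff)
    then have "0 < (norm (E x))\<^sup>2" by simp
    then show "0 < inner x (P *v x)" unfolding P using F(4)[of "E x"] by linarith
  qed
  moreover have "psd (- (transpose A ** P + P ** A + \<delta> *\<^sub>R P))"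
    unfolding psd_def
  proof (intro conjI allI)
    have tr: "transpose (U + V) = transpose U + transpose V" "transpose (- U) = - transpose U"
      "transpose (U - V) = transpose U - transpose V"
      "transpose (c *\<^sub>R U) = c *\<^sub>R transpose U" for U V :: "real ^ 'n ^ 'n" and c
      by (simp_all add: transpose_def vec_eq_iff)
    show "transpose (- (transpose A ** P + P ** A + \<delta> *\<^sub>R P)) = - (transpose A ** P + P ** A + \<delta> *\<^sub>R P)"
      unfolding tr matrix_transpose_mul symP transpose_transpose by (simp only: add.commute)
    fix x
    have "inner x ((transpose A ** P) *v x) = inner x (P *v (A *v x))"
    proof -
      have "inner x ((transpose A ** P) *v x) = inner (A *v x) (P *v x)"
        by (simp only: matrix_vector_mul_assoc[symmetric] dot_lmul_matrix[symmetric] vector_transpose_matrix)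
      also have "\<dots> = inner x (P *v (A *v x))" unfolding P by (rule F(2))
      finally show ?thesis .
    qed
    moreover have "- U *v x = - (U *v x)" for U :: "real ^ 'n ^ 'n"
      by (simp add: vec_eq_iff matrix_vector_mult_def sum_negf)
    ultimately have "inner x (- (transpose A ** P + P ** A + \<delta> *\<^sub>R P) *v x)
        = - (2 * inner x (P *v (A *v x)) + \<delta> * inner x (P *v x))"
      by (simp add: matrix_vector_mult_add_rdistrib matrix_vector_mult_diff_rdistrib inner_add_right inner_diff_right matrix_vector_mul_assoc
        scaleR_matrix_vector_assoc[symmetric] inner_minus_right)
    then show "0 \<le> inner x (- (transpose A ** P + P ** A + \<delta> *\<^sub>R P) *v x)"
      using F(5)[of "E x"] unfolding P EA by simp
  qed
  ultimately show ?thesis using F(3) that by blast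
qed

lemma hurwitz_imp_admissible_params_nonempty:
  fixes A :: "real ^ 'n ^ 'n"
  assumes "hurwitz A"
  shows "admissible_params A \<noteq> {}"
proof -
  obtain P \<delta> where P: "pos_def P" "0 < \<delta>" "psd (- (transpose A ** P + P ** A + \<delta> *\<^sub>R P))"
    using hurwitz_imp_lyapunov[OF assms] by blast
  have "mat (sqrt (\<delta> / 2)) ** Q = sqrt (\<delta> / 2) *\<^sub>R Q" "Q ** mat (sqrt (\<delta> / 2)) = sqrt (\<delta> / 2) *\<^sub>R Q"
    for Q :: "real ^ 'n ^ 'n"
    by (simp_all add: vec_eq_iff matrix_matrix_mult_def mat_def if_distrib if_distribR cong: if_cong)
  then have "transpose (mat (sqrt (\<delta> / 2))) ** P ** mat (sqrt (\<delta> / 2)) = (\<delta> / 2) *\<^sub>R P"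
    using P(2) by simp
  then have "transpose A ** P + P ** A
        + (\<Sum>\<Gamma>\<leftarrow>mat (sqrt (\<delta> / 2)) # [0]. transpose \<Gamma> ** P ** \<Gamma>) + (\<delta> / 2) *\<^sub>R P
      = transpose A ** P + P ** A + \<delta> *\<^sub>R P"
    by (simp add: scaleR_left_distrib[symmetric] add.assoc)
  then have "psd (- (transpose A ** P + P ** A
        + (\<Sum>\<Gamma>\<leftarrow>mat (sqrt (\<delta> / 2)) # [0]. transpose \<Gamma> ** P ** \<Gamma>) + (\<delta> / 2) *\<^sub>R P))"
    using P(3) by (simp only:)
  then have "(\<delta> / 2, [0]) \<in> admissible_params A"
    unfolding admissible_params_def mem_Collect_eq prod.case
    using P(1,2) by (intro conjI exI[of _ P] exI[of _ "\<delta> / 2"]) simp_all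
  then show ?thesis by blast
qed

section \<open>Gram factorization and Hilbert space valued processes\<close>

text \<open>Each index \<open>a\<close> is one elimination step of Cholesky's method. The claim on
  the rows of \<open>Q\<close> outside \<open>S\<close> keeps row \<open>a\<close> of the smaller
  factor empty, so that it can receive the pivot row.\<close>

lemma psd_eq_gram_aux:
  fixes P :: "real ^ 'n ^ 'n"
  assumes "finite S" "psd P" "\<And>j k. j \<notin> S \<Longrightarrow> P $ j $ k = 0"
  shows "\<exists>Q. P = transpose Q ** Q \<and> (\<forall>i j. i \<notin> S \<longrightarrow> Q $ i $ j = 0)"
  using assms
proof (induction S arbitrary: P)
  case empty
  then have "P = 0" by (simp add: vec_eq_iff)
  then show ?case by (intro exI[of _ 0]) simp
next
  case (insert a S)
  have sym: "P $ j $ k = P $ k $ j" for j k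
    using insert.prems(1) by (auto simp: psd_def transpose_def vec_eq_iff)
  define b where "b x = (\<Sum>j\<in>UNIV. x $ j * P $ j $ a)" for x :: "real ^ 'n"
  let ?q = "\<lambda>x. inner x (P *v x)"
  have col: "(P *v axis a 1) $ j = P $ j $ a" for j
    by (simp add: matrix_vector_mult_basis column_def)
  have bx: "inner x (P *v axis a 1) = b x" for x
    by (simp add: inner_vec_def b_def col)
  have bx': "inner (axis a 1) (P *v x) = b x" for x
    by (simp add: inner_axis' b_def matrix_vector_mult_def sym[of a] mult.commute)
  have expand: "?q (x + t *\<^sub>R axis a 1) = ?q x + 2 * t * b x + t\<^sup>2 * P $ a $ a" for x t
  proof -
    have "inner (axis a 1) (P *v axis a 1) = P $ a $ a"
      by (simp add: inner_axis' col)
    then show ?thesis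
      unfolding matrix_vector_right_distrib matrix_vector_mult_scaleR inner_add_left
        inner_add_right inner_scaleR_left inner_scaleR_right
      unfolding bx bx'
      by (simp add: power2_eq_square distrib_left)
  qed
  have nonneg: "0 \<le> ?q x + 2 * t * b x + t\<^sup>2 * P $ a $ a" for x t
    using insert.prems(1) unfolding expand[symmetric] psd_def by blast
  have diag: "0 \<le> P $ a $ a"
    using nonneg[of 0 1] by (simp add: b_def)
  show ?case
  proof (cases "P $ a $ a = 0")
    case True
    \<comment> \<open>With a zero pivot the form is affine in \<open>t\<close>; a nonzero slope
      would bring it down to -1. Hence the whole row and column of \<open>a\<close> vanish.\<close>
    have b0: "b x = 0" for x
    proof (rule ccontr)
      assume "b x \<noteq> 0"
      then have "?q x + 2 * (- (?q x + 1) / (2 * b x)) * b x + (- (?q x + 1) / (2 * b x))\<^sup>2 * P $ a $ a = -1"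
        using True by (simp add: field_simps)
      then show False using nonneg[of x "- (?q x + 1) / (2 * b x)"] by linarith
    qed
    have "b (axis k 1) = P $ k $ a" for k
      by (simp add: b_def axis_def if_distrib if_distribR cong: if_cong)
    then have "P $ j $ k = 0" if "j \<notin> S" for j k
      using insert.prems(2)[of j k] that b0 sym by (metis insert_iff)
    then show ?thesis using insert.IH[OF insert.prems(1)] by blast
  next
    case False
    then have pos: "0 < P $ a $ a" using diag by simp
    \<comment> \<open>The Schur complement. It stays positive semidefinite because
      \<open>inner x (P' *v x)\<close> is the value of the form of \<open>P\<close> at
      \<open>x + t *\<^sub>R axis a 1\<close> with the minimising
      \<open>t = - b x / P $ a $ a\<close>.\<close>
    define P' :: "real ^ 'n ^ 'n" where
      "P' = (\<chi> j k. P $ j $ k - P $ j $ a * P $ k $ a / P $ a $ a)"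
    have "?q x - (b x)\<^sup>2 / P $ a $ a = inner x (P' *v x)" for x
    proof -
      have "(b x)\<^sup>2 = (\<Sum>j\<in>UNIV. \<Sum>k\<in>UNIV. x $ j * P $ j $ a * (x $ k * P $ k $ a))"
        by (simp add: b_def power2_eq_square sum_product)
      then show ?thesis
        by (simp add: P'_def inner_vec_def matrix_vector_mult_def sum_distrib_left sum_divide_distrib
            sum_subtractf[symmetric] algebra_simps)
    qed
    moreover have "0 \<le> ?q x - (b x)\<^sup>2 / P $ a $ a" for x
      using nonneg[of x "- b x / P $ a $ a"] pos by (simp add: power2_eq_square field_simps)
    moreover have "transpose P' = P'"
      by (simp add: P'_def transpose_def vec_eq_iff sym mult.commute)
    ultimately have "psd P'" by (simp add: psd_def)
    moreover have "P' $ j $ k = 0" if "j \<notin> S" for j k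
      using insert.prems(2)[of j] that pos sym[of a k] by (cases "j = a") (auto simp: P'_def)
    ultimately obtain Q' where Q': "P' = transpose Q' ** Q'" "\<And>i j. i \<notin> S \<Longrightarrow> Q' $ i $ j = 0"
      using insert.IH by blast
    define Q :: "real ^ 'n ^ 'n" where
      "Q = (\<chi> i j. if i = a then P $ a $ j / sqrt (P $ a $ a) else Q' $ i $ j)"
    have "(transpose Q ** Q) $ j $ k = P $ j $ k" for j k
    proof -
      have "(transpose Q ** Q) $ j $ k = (\<Sum>i\<in>UNIV. Q $ i $ j * Q $ i $ k)"
        by (simp add: matrix_matrix_mult_def transpose_def)
      also have "\<dots> = Q $ a $ j * Q $ a $ k + (\<Sum>i\<in>UNIV - {a}. Q $ i $ j * Q $ i $ k)"
        by (rule sum.remove) auto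
      also have "(\<Sum>i\<in>UNIV - {a}. Q $ i $ j * Q $ i $ k) = (\<Sum>i\<in>UNIV. Q' $ i $ j * Q' $ i $ k)"
        using Q'(2)[of a] insert.hyps(2)
        by (intro sum.mono_neutral_cong_left) (auto simp: Q_def)
      also have "\<dots> = P' $ j $ k"
        unfolding Q'(1) by (simp add: matrix_matrix_mult_def transpose_def)
      also have "Q $ a $ j * Q $ a $ k = P $ j $ a * P $ k $ a / P $ a $ a"
        using pos by (simp add: Q_def sym[of j a] sym[of k a])
      finally show ?thesis by (simp add: P'_def)
    qed
    then have "P = transpose Q ** Q" by (simp add: vec_eq_iff)
    moreover have "Q $ i $ j = 0" if "i \<notin> insert a S" for i j
      using that Q'(2) by (simp add: Q_def)
    ultimately show ?thesis by blast
  qed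
qed

lemma psd_eq_gram:
  fixes P :: "real ^ 'n ^ 'n"
  assumes "psd P"
  obtains Q :: "real ^ 'n ^ 'n" where "P = transpose Q ** Q"
proof -
  have "\<exists>Q :: real ^ 'n ^ 'n. P = transpose Q ** Q \<and> (\<forall>i j. i \<notin> UNIV \<longrightarrow> Q $ i $ j = 0)"
    using assms by (intro psd_eq_gram_aux) auto
  then show ?thesis using that by blast
qed

section \<open>Orthogonal projection onto a closed subspace\<close>

lemma closed_subspace_projection:
  fixes S :: "'k::{real_inner, complete_space} set"
  assumes "closed S" "subspace S"
  obtains p where "p \<in> S" "\<And>s. s \<in> S \<Longrightarrow> inner s (y - p) = 0"
proof -
  have ne: "S \<noteq> {}" using assms(2) subspace_0 by blast
  define d where "d = infdist y S"
  have d0: "0 \<le> d" by (simp add: d_def infdist_nonneg)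
  have dle: "d \<le> norm (y - s)" if "s \<in> S" for s
    using infdist_le[OF that, of y] by (simp add: d_def dist_norm)
  have "\<exists>s\<in>S. norm (y - s) < d + inverse (real (Suc n))" for n
  proof -
    have "infdist y S < d + inverse (real (Suc n))" by (simp add: d_def)
    then have "(INF s\<in>S. dist y s) < d + inverse (real (Suc n))"
      using ne by (simp add: infdist_def)
    then show ?thesis
      using ne by (subst (asm) cINF_less_iff) (auto simp: dist_norm intro!: bdd_belowI2[of _ 0])
  qed
  then obtain s where s: "\<And>n. s n \<in> S" "\<And>n. norm (y - s n) < d + inverse (real (Suc n))"
    by metis
  have up: "(\<lambda>n. d + inverse (real (Suc n))) \<longlonglongrightarrow> d"
    using tendsto_add[OF tendsto_const LIMSEQ_inverse_real_of_nat, of d] by simp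
  have lo: "\<forall>\<^sub>F n in sequentially. d \<le> norm (y - s n)"
    by (rule always_eventually) (use s(1) dle in blast)
  have hi: "\<forall>\<^sub>F n in sequentially. norm (y - s n) \<le> d + inverse (real (Suc n))"
    by (rule always_eventually) (use s(2) less_imp_le in blast)
  have lim: "(\<lambda>n. norm (y - s n)) \<longlonglongrightarrow> d"
    by (rule tendsto_sandwich[OF lo hi tendsto_const up])
  from lim have sq: "(\<lambda>n. (norm (y - s n))\<^sup>2) \<longlonglongrightarrow> d\<^sup>2"
    by (rule tendsto_power)
  \<comment> \<open>The parallelogram law, with the midpoint of \<open>s m\<close> and
    \<open>s n\<close> in \<open>S\<close> and thus at distance at least \<open>d\<close> from
    \<open>y\<close>. It makes the minimising sequence Cauchy.\<close>
  have par: "(norm (s m - s n))\<^sup>2 \<le> 2 * (norm (y - s m))\<^sup>2 + 2 * (norm (y - s n))\<^sup>2 - 4 * d\<^sup>2" for m n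
  proof -
    have "(1/2) *\<^sub>R (s m + s n) \<in> S"
      using s(1) assms(2) by (simp add: subspace_add subspace_scale)
    then have "d\<^sup>2 \<le> (norm (y - (1/2) *\<^sub>R (s m + s n)))\<^sup>2"
      using dle d0 by (intro power_mono) auto
    moreover have "(norm (s m - s n))\<^sup>2 + 4 * (norm (y - (1/2) *\<^sub>R (s m + s n)))\<^sup>2
        = 2 * (norm (y - s m))\<^sup>2 + 2 * (norm (y - s n))\<^sup>2"
    proof -
      define u v where "u = y - s m" and "v = y - s n"
      have eqs: "s m - s n = v - u" "y - (1/2) *\<^sub>R (s m + s n) = (1/2) *\<^sub>R (u + v)"
        by (simp_all add: u_def v_def scaleR_add_right scaleR_diff_right add_diff_add
            flip: scaleR_left_distrib)
      show ?thesis
        unfolding eqs u_def[symmetric] v_def[symmetric] power2_norm_eq_inner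
        by (simp add: inner_add_left inner_add_right inner_diff_left inner_diff_right field_simps)
    qed
    ultimately show ?thesis by linarith
  qed
  have "Cauchy s"
  proof (rule metric_CauchyI)
    fix e :: real assume e: "0 < e"
    then have "eventually (\<lambda>n. (norm (y - s n))\<^sup>2 < d\<^sup>2 + e\<^sup>2 / 4) sequentially"
      using sq by (intro order_tendstoD(2)[of _ "d\<^sup>2"]) auto
    then obtain M where M: "\<And>n. M \<le> n \<Longrightarrow> (norm (y - s n))\<^sup>2 < d\<^sup>2 + e\<^sup>2 / 4"
      by (auto simp: eventually_sequentially)
    have "dist (s m) (s n) < e" if "M \<le> m" "M \<le> n" for m n
    proof -
      have "(norm (s m - s n))\<^sup>2 < e\<^sup>2"
        using par[of m n] M[OF that(1)] M[OF that(2)] by linarith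
      then show ?thesis using e by (simp add: dist_norm power_less_imp_less_base)
    qed
    then show "\<exists>M. \<forall>m\<ge>M. \<forall>n\<ge>M. dist (s m) (s n) < e" by blast
  qed
  then obtain p where p: "s \<longlonglongrightarrow> p" using Cauchy_convergent_iff convergent_def by blast
  have pS: "p \<in> S" using closed_sequentially[OF assms(1) _ p] s(1) by blast
  have "(\<lambda>n. norm (y - s n)) \<longlonglongrightarrow> norm (y - p)"
    by (intro tendsto_intros p)
  then have pd: "norm (y - p) = d"
    using lim LIMSEQ_unique by blast
  have "inner v (y - p) = 0" if v: "v \<in> S" for v
  proof (cases "v = 0")
    case False
    \<comment> \<open>The best step along \<open>v\<close>: unless the inner product vanishes, it
      would lead from \<open>p\<close> to a point of \<open>S\<close> nearer to
      \<open>y\<close>.\<close>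
    define t where "t = inner v (y - p) / (norm v)\<^sup>2"
    have nv: "(norm v)\<^sup>2 > 0" using False by simp
    have "p + t *\<^sub>R v \<in> S"
      using v pS assms(2) by (simp add: subspace_add subspace_scale)
    then have "(norm (y - p))\<^sup>2 \<le> (norm (y - (p + t *\<^sub>R v)))\<^sup>2"
      using dle d0 unfolding pd by (intro power_mono) auto
    also have "\<dots> = (norm ((y - p) - t *\<^sub>R v))\<^sup>2" by (simp add: algebra_simps)
    also have "\<dots> = (norm (y - p))\<^sup>2 - 2 * t * inner v (y - p) + t\<^sup>2 * (norm v)\<^sup>2"
      unfolding power2_norm_eq_inner inner_diff_left[of "y - p"] inner_diff_right[of _ "y - p"]
      by (simp add: inner_commute[of "y - p" v] power2_eq_square)
    finally have "2 * t * inner v (y - p) \<le> t\<^sup>2 * (norm v)\<^sup>2" by linarith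
    also have "\<dots> = t * inner v (y - p)"
      using nv by (simp add: t_def power2_eq_square)
    finally have "t * inner v (y - p) \<le> 0" by linarith
    then have "(inner v (y - p))\<^sup>2 / (norm v)\<^sup>2 \<le> 0"
      by (simp add: t_def power2_eq_square)
    then show ?thesis using nv by (simp add: divide_le_0_iff)
  qed simp
  then show ?thesis using pS that by blast
qed

section \<open>A differential inequality with upper Dini derivatives\<close>

text \<open>Consider the last time at which \<open>V\<close> is below a comparison curve. One
  explicit Euler step from there stays below the curve, because \<open>1 - \<gamma> * h\<close> is
  at most \<open>exp (- \<gamma> * h)\<close>, and so contradicts the choice of that time.\<close>

lemma dini_comparison:
  fixes V :: "real \<Rightarrow> real"
  assumes cont: "\<And>T. continuous_on {0..T} V"
    and "0 < \<gamma>" "0 \<le> V 0"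
    and dini: "\<And>s \<epsilon>. 0 \<le> s \<Longrightarrow> 0 < \<epsilon> \<Longrightarrow>
      \<exists>\<delta>>0. \<forall>h. 0 < h \<and> h < \<delta> \<longrightarrow> V (s + h) \<le> V s + h * (C - \<gamma> * V s + \<epsilon>)"
    and "0 \<le> t"
  shows "V t \<le> exp (- \<gamma> * t) * V 0 + \<bar>C\<bar> / \<gamma>"
proof (rule field_le_epsilon)
  fix e :: real assume "0 < e"
  define \<epsilon> where "\<epsilon> = \<gamma> * e"
  have \<epsilon>: "0 < \<epsilon>" using \<open>0 < e\<close> \<open>0 < \<gamma>\<close> by (simp add: \<epsilon>_def)
  \<comment> \<open>The solution of the linear equation with rate \<gamma> and source
    \<open>\<bar>C\<bar> + \<epsilon>\<close>. The absolute value ensures that the curve starts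
    above \<open>V 0\<close>, and \<epsilon> is scaled so that it raises the curve by exactly
    \<open>e\<close>.\<close>
  define F where "F r = exp (- \<gamma> * r) * V 0 + (\<bar>C\<bar> + \<epsilon>) / \<gamma>" for r
  have "V t \<le> F t"
  proof (rule ccontr)
    assume neg: "\<not> V t \<le> F t"
    define S where "S = {r \<in> {0..t}. V r \<le> F r}"
    have "closed S"
      unfolding S_def
      by (intro continuous_on_closed_Collect_le cont closed_atLeastAtMost)
        (auto simp: F_def intro!: continuous_intros)
    moreover have "S \<noteq> {}"
      using \<open>0 \<le> t\<close> \<epsilon> \<open>0 < \<gamma>\<close> by (auto simp: S_def F_def intro!: exI[of _ 0])
    moreover have bdd: "bdd_above S"
      by (auto simp: S_def bdd_above_def)
    ultimately have "Sup S \<in> S"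
      using closed_contains_Sup by blast
    define s where "s = Sup S"
    have s: "0 \<le> s" "s \<le> t" "V s \<le> F s"
      using \<open>Sup S \<in> S\<close> by (auto simp: s_def S_def)
    have "s < t" using s neg by (cases "s = t") auto
    obtain \<delta> where \<delta>: "0 < \<delta>"
      "\<And>h. 0 < h \<Longrightarrow> h < \<delta> \<Longrightarrow> V (s + h) \<le> V s + h * (C - \<gamma> * V s + \<epsilon>)"
      using dini[OF s(1) \<epsilon>] by blast
    \<comment> \<open>The bound \<open>1 / \<gamma>\<close> keeps the Euler factor
      \<open>1 - h * \<gamma>\<close> nonnegative, so that it preserves the inequality between
      \<open>V s\<close> and \<open>F s\<close>.\<close>
    define h where "h = min (\<delta> / 2) (min (t - s) (1 / \<gamma>))"
    have h: "0 < h" "h < \<delta>" "h \<le> t - s"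
      using \<delta>(1) \<open>s < t\<close> \<open>0 < \<gamma>\<close> by (auto simp: h_def)
    have "h \<le> 1 / \<gamma>" by (simp add: h_def)
    then have h4: "h * \<gamma> \<le> 1" using \<open>0 < \<gamma>\<close> by (simp add: field_simps)
    have "V (s + h) \<le> (1 - h * \<gamma>) * V s + h * (C + \<epsilon>)"
      using \<delta>(2)[OF h(1,2)] by (simp add: algebra_simps)
    also have "(1 - h * \<gamma>) * V s \<le> (1 - h * \<gamma>) * F s"
      using s(3) h4 by (intro mult_left_mono) auto
    also have "h * (C + \<epsilon>) \<le> h * (\<bar>C\<bar> + \<epsilon>)" using h(1) by (intro mult_left_mono) auto
    also have "(1 - h * \<gamma>) * F s + h * (\<bar>C\<bar> + \<epsilon>)
        = (1 + (- \<gamma> * h)) * (exp (- \<gamma> * s) * V 0) + (\<bar>C\<bar> + \<epsilon>) / \<gamma>"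
      using \<open>0 < \<gamma>\<close> by (simp add: F_def field_simps)
    also have "(1 + (- \<gamma> * h)) * (exp (- \<gamma> * s) * V 0) \<le> exp (- \<gamma> * h) * (exp (- \<gamma> * s) * V 0)"
      using exp_ge_add_one_self[of "- \<gamma> * h"] \<open>0 \<le> V 0\<close> by (intro mult_right_mono) auto
    also have "\<dots> + (\<bar>C\<bar> + \<epsilon>) / \<gamma> = F (s + h)"
      by (simp add: F_def exp_add[symmetric] algebra_simps mult.assoc[symmetric])
    finally have "s + h \<in> S" using s h by (simp add: S_def)
    then have "s + h \<le> s" unfolding s_def using bdd by (rule cSup_upper)
    then show False using h(1) by simp
  qed
  also have "F t = exp (- \<gamma> * t) * V 0 + \<bar>C\<bar> / \<gamma> + e"
    using \<open>0 < \<gamma>\<close> by (simp add: F_def \<epsilon>_def field_simps)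
  finally show "V t \<le> exp (- \<gamma> * t) * V 0 + \<bar>C\<bar> / \<gamma> + e" .
qed

text \<open>An Ito formula in the form of an inequality: over a short step the square of the martingale
  increment is at most \<open>L\<close> times the step, and its product with \<open>a s\<close> vanishes.\<close>

lemma adapted_process_mean_square_bound:
  fixes a b w :: "real \<Rightarrow> 'k::{real_inner, banach}"
  assumes int: "\<And>t. 0 \<le> t \<Longrightarrow> (b has_integral (a t - a 0 - w t)) {0..t}"
    and orth: "\<And>s t. 0 \<le> s \<Longrightarrow> s \<le> t \<Longrightarrow> inner (a s) (w t - w s) = 0"
    and L: "\<And>s t. 0 \<le> s \<Longrightarrow> s \<le> t \<Longrightarrow> (norm (w t - w s))\<^sup>2 \<le> L * (t - s)"
    and K: "\<And>r. 0 \<le> r \<Longrightarrow> norm (b r) \<le> K * (norm (a r) + 1)"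
    and diss: "\<And>r. 0 \<le> r \<Longrightarrow> 2 * inner (a r) (b r) \<le> C - \<gamma> * (norm (a r))\<^sup>2"
    and "0 < \<gamma>" and "0 \<le> t"
  shows "(norm (a t))\<^sup>2 \<le> exp (- \<gamma> * t) * (norm (a 0))\<^sup>2 + \<bar>C + 2 * L\<bar> / \<gamma>"
proof (rule dini_comparison[OF _ \<open>0 < \<gamma>\<close> _ _ \<open>0 \<le> t\<close>])
  have L0: "0 \<le> L" using L[of 0 1] by (auto intro: order_trans[OF zero_le_power2])
  have contw: "continuous_on {0..T} w" for T
    unfolding continuous_on_iff
  proof (intro ballI allI impI)
    fix s e :: real assume s: "s \<in> {0..T}" and e: "0 < e"
    show "\<exists>d>0. \<forall>r\<in>{0..T}. dist r s < d \<longrightarrow> dist (w r) (w s) < e"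
    proof (intro exI[of _ "e\<^sup>2 / (L + 1)"] conjI ballI impI)
      show "0 < e\<^sup>2 / (L + 1)" using e L0 by simp
      fix r assume r: "r \<in> {0..T}" "dist r s < e\<^sup>2 / (L + 1)"
      have "(norm (w r - w s))\<^sup>2 \<le> L * \<bar>r - s\<bar>"
        using L[of r s] L[of s r] r s by (cases "r \<le> s") (auto simp: norm_minus_commute)
      also have "\<dots> \<le> (L + 1) * \<bar>r - s\<bar>" by (intro mult_right_mono) auto
      also have "\<dots> < e\<^sup>2"
        using r(2) L0 by (simp add: dist_real_def field_simps)
      finally show "dist (w r) (w s) < e"
        using e by (simp add: dist_norm power_less_imp_less_base)
    qed
  qed
  have a_eq: "a r = a 0 + w r + integral {0..r} b" if "0 \<le> r" for r
    using integral_unique[OF int[OF that]] by simp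
  have bint: "b integrable_on {0..T}" if "0 \<le> T" for T
    using int[OF that] by blast
  have conta: "continuous_on {0..T} a" for T
  proof (cases "0 \<le> T")
    case True
    have "continuous_on {0..T} (\<lambda>r. a 0 + w r + integral {0..r} b)"
      by (intro continuous_intros contw indefinite_integral_continuous_1 bint True)
    then show ?thesis
      by (rule continuous_on_eq) (rule a_eq[symmetric], simp)
  qed simp
  show contV: "continuous_on {0..T} (\<lambda>t. (norm (a t))\<^sup>2)" for T
    by (intro continuous_intros conta)
  show "0 \<le> (norm (a 0))\<^sup>2" by simp
  fix s \<epsilon> :: real assume s: "0 \<le> s" and \<epsilon>: "0 < \<epsilon>"
  \<comment> \<open>The growth bound turns boundedness of \<open>a\<close> near \<open>s\<close>
    into boundedness of \<open>b\<close>, which gives a drift increment of order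
    \<open>h\<close>.\<close>
  have "bounded (a ` {0..s + 1})"
    by (intro compact_imp_bounded compact_continuous_image conta) simp
  then obtain M where M: "\<And>r. r \<in> {0..s + 1} \<Longrightarrow> norm (a r) \<le> M"
    unfolding bounded_iff by blast
  define N where "N = \<bar>K\<bar> * (M + 1) + 1"
  have M0: "0 \<le> M" using M[of 0] s order_trans[OF norm_ge_zero] by auto
  have N: "0 < N" using M0 by (simp add: N_def add_nonneg_pos)
  have bN: "norm (b r) \<le> N" if "r \<in> {0..s + 1}" for r
  proof -
    have "norm (b r) \<le> K * (norm (a r) + 1)" using K that by simp
    also have "\<dots> \<le> \<bar>K\<bar> * (M + 1)" using M[OF that] by (intro mult_mono) auto
    finally show ?thesis by (simp add: N_def)
  qed
  obtain \<delta>1 where \<delta>1: "0 < \<delta>1"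
    "\<And>r. r \<in> {0..s + 1} \<Longrightarrow> dist r s < \<delta>1 \<Longrightarrow> dist (a r) (a s) < \<epsilon> / (6 * N)"
    using conta[of "s + 1", unfolded continuous_on_iff, rule_format, of s "\<epsilon> / (6 * N)"] \<epsilon> N s
    by auto
  obtain \<delta>2 where \<delta>2: "0 < \<delta>2"
    "\<And>r. r \<in> {0..s + 1} \<Longrightarrow> dist r s < \<delta>2 \<Longrightarrow> dist ((norm (a r))\<^sup>2) ((norm (a s))\<^sup>2) < \<epsilon> / (3 * \<gamma>)"
    using contV[of "s + 1", unfolded continuous_on_iff, rule_format, of s "\<epsilon> / (3 * \<gamma>)"] \<epsilon>
      \<open>0 < \<gamma>\<close> s
    by auto
  \<comment> \<open>Three errors of size \<open>\<epsilon> / 3\<close> per unit of time: replacing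
    \<open>a r\<close> by \<open>a s\<close> in the product with \<open>b r\<close>, replacing the
    squared norm of \<open>a r\<close> by that of \<open>a s\<close>, and the square of the drift
    increment \<open>d\<close>.\<close>
  define \<delta> where "\<delta> = min (min \<delta>1 \<delta>2) (min 1 (\<epsilon> / (6 * N\<^sup>2)))"
  have \<delta>: "0 < \<delta>" "\<delta> \<le> \<delta>1" "\<delta> \<le> \<delta>2" "\<delta> \<le> 1" "\<delta> \<le> \<epsilon> / (6 * N\<^sup>2)"
    using \<delta>1(1) \<delta>2(1) \<epsilon> N by (auto simp: \<delta>_def)
  have "(norm (a (s + h)))\<^sup>2 \<le> (norm (a s))\<^sup>2 + h * (C + 2 * L - \<gamma> * (norm (a s))\<^sup>2 + \<epsilon>)"
    if h: "0 < h" "h < \<delta>" for h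
  proof -
    define W where "W = w (s + h) - w s"
    define d where "d = a (s + h) - a s - W"
    have d: "(b has_integral d) {s..s + h}"
    proof -
      have "integral {0..s} b + integral {s..s + h} b = integral {0..s + h} b"
        using s h by (intro Henstock_Kurzweil_Integration.integral_combine bint) auto
      then have "integral {s..s + h} b = d"
        using a_eq[of s] a_eq[of "s + h"] s h by (simp add: d_def W_def algebra_simps)
      moreover have "b integrable_on {s..s + h}"
        using s h by (intro integrable_on_subinterval[OF bint[of "s + h"]]) auto
      ultimately show ?thesis by (metis integrable_integral)
    qed
    have nd: "norm d \<le> N * h"
      using has_integral_bound[of N b d s "s + h"] d bN h \<delta>(4) s N by (auto simp: cbox_interval)
    define c where "c = (C - \<gamma> * (norm (a s))\<^sup>2 + 2 * \<epsilon> / 3) / 2"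
    \<comment> \<open>Continuity of \<open>b\<close> is not assumed, so \<open>b r\<close> is kept
      and only \<open>a r\<close> is moved to \<open>a s\<close> in the dissipation
      inequality.\<close>
    have pw: "inner (a s) (b r) \<le> c" if r: "r \<in> {s..s + h}" for r
    proof -
      have r': "r \<in> {0..s + 1}" "dist r s < \<delta>1" "dist r s < \<delta>2" "0 \<le> r"
        using r s h \<delta> by (auto simp: dist_real_def)
      have "inner (a s - a r) (b r) \<le> norm (a s - a r) * norm (b r)"
        by (rule norm_cauchy_schwarz)
      also have "\<dots> \<le> \<epsilon> / (6 * N) * N"
        using \<delta>1(2)[OF r'(1,2)] bN[OF r'(1)] \<epsilon> N
        by (intro mult_mono) (auto simp: dist_norm norm_minus_commute)
      finally have "2 * inner (a s - a r) (b r) \<le> \<epsilon> / 3" using N by simp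
      moreover have "2 * inner (a r) (b r) \<le> C - \<gamma> * (norm (a r))\<^sup>2"
        by (rule diss[OF r'(4)])
      moreover have "\<gamma> * ((norm (a s))\<^sup>2 - (norm (a r))\<^sup>2) \<le> \<gamma> * (\<epsilon> / (3 * \<gamma>))"
        using \<delta>2(2)[OF r'(1,3)] \<open>0 < \<gamma>\<close> by (intro mult_left_mono) (auto simp: dist_real_def)
      ultimately show ?thesis
        using \<open>0 < \<gamma>\<close> by (simp add: c_def inner_diff_left algebra_simps)
    qed
    have "((\<lambda>r. inner (a s) (b r)) has_integral inner (a s) d) {s..s + h}"
      using has_integral_linear[OF d bounded_linear_inner_right[of "a s"]] by (simp add: o_def)
    moreover have "((\<lambda>r. c) has_integral h * c) {s..s + h}"
      using has_integral_const_real[of c s "s + h"] h by simp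
    ultimately have 1: "inner (a s) d \<le> h * c"
      using pw by (rule has_integral_le)
    \<comment> \<open>The drift increment \<open>d\<close> depends on times after \<open>s\<close>
      and need not be orthogonal to \<open>W\<close>. This cruder bound is the source of the factor
      2 in front of \<open>L\<close>.\<close>
    have 2: "(norm (d + W))\<^sup>2 \<le> 2 * (norm d)\<^sup>2 + 2 * (norm W)\<^sup>2"
    proof -
      have "0 \<le> (norm (d - W))\<^sup>2" by simp
      then show ?thesis
        unfolding power2_norm_eq_inner
        by (simp add: inner_add_left inner_add_right inner_diff_left inner_diff_right)
    qed
    have 3: "(norm W)\<^sup>2 \<le> L * h" using L[of s "s + h"] s h by (simp add: W_def)
    have 4: "2 * (norm d)\<^sup>2 \<le> h * (\<epsilon> / 3)"
    proof -
      have "2 * (norm d)\<^sup>2 \<le> 2 * (N * h)\<^sup>2" using nd by (intro mult_left_mono power_mono) auto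
      also have "\<dots> = h * (2 * N\<^sup>2 * h)" by (simp add: power2_eq_square)
      also have "\<dots> \<le> h * (2 * N\<^sup>2 * (\<epsilon> / (6 * N\<^sup>2)))"
        using h \<delta>(5) by (intro mult_left_mono) auto
      also have "\<dots> = h * (\<epsilon> / 3)" using N by simp
      finally show ?thesis .
    qed
    have 5: "inner (a s) W = 0" using orth[of s "s + h"] s h by (simp add: W_def)
    have norm_add_sq: "(norm (x + y))\<^sup>2 = (norm x)\<^sup>2 + 2 * inner x y + (norm y)\<^sup>2" for x y :: 'k
      unfolding power2_norm_eq_inner by (simp add: inner_add_left inner_add_right inner_commute)
    have eq: "a s + (d + W) = a (s + h)" by (simp add: d_def)
    from norm_add_sq[of "a s" "d + W", unfolded eq]
    have "(norm (a (s + h)))\<^sup>2 = (norm (a s))\<^sup>2 + 2 * inner (a s) d + (norm (d + W))\<^sup>2"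
      using 5 by (simp add: inner_add_right)
    moreover have "h * (C + 2 * L - \<gamma> * (norm (a s))\<^sup>2 + \<epsilon>) = 2 * (h * c) + h * (\<epsilon> / 3) + 2 * (L * h)"
      by (simp add: c_def field_simps)
    ultimately show ?thesis
      using 1 2 3 4 by linarith
  qed
  then show "\<exists>\<delta>>0. \<forall>h. 0 < h \<and> h < \<delta> \<longrightarrow>
      (norm (a (s + h)))\<^sup>2 \<le> (norm (a s))\<^sup>2 + h * (C + 2 * L - \<gamma> * (norm (a s))\<^sup>2 + \<epsilon>)"
    using \<delta>(1) by blast
qed

section \<open>Fock space\<close>

subclass (in complex_hilbert_space) banach ..

section \<open>Complex and real inner products\<close>

lemma cinner_add_left: "cinner (x + y) z = cinner x z + cinner y z"
  by (metis cinner_add_right cinner_commute complex_cnj_add)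

lemma cinner_scaleC_left: "cinner (a *\<^sub>C x) y = cnj a * cinner x y"
  by (metis cinner_commute cinner_scaleC_right complex_cnj_mult)

lemma cinner_zero_right [simp]: "cinner x 0 = 0"
  using cinner_add_right[of x 0 0] by simp

lemma cinner_zero_left [simp]: "cinner 0 x = 0"
  using cinner_add_left[of 0 0 x] by simp

lemma cinner_scaleR_right: "cinner x (r *\<^sub>R y) = of_real r * cinner x y"
  by (simp add: scaleR_scaleC cinner_scaleC_right)

lemma cinner_scaleR_left: "cinner (r *\<^sub>R x) y = of_real r * cinner x y"
  by (simp add: scaleR_scaleC cinner_scaleC_left)

lemma cinner_diff_right: "cinner x (y - z) = cinner x y - cinner x z"
  using cinner_add_right[of x "y - z" z] by simp

lemma cinner_diff_left: "cinner (x - y) z = cinner x z - cinner y z"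
  using cinner_add_left[of "x - y" y z] by simp

lemma cinner_sum_right: "cinner x (sum f S) = (\<Sum>i\<in>S. cinner x (f i))"
  by (induction S rule: infinite_finite_induct) (simp_all add: cinner_add_right)

lemma scaleC_minus_one: "(-1) *\<^sub>C x = - x"
  using scaleR_scaleC[of "-1" x] by simp

lemma cinner_self: "cinner x x = of_real ((norm x)\<^sup>2)"
proof (rule complex_eqI)
  show "Re (cinner x x) = Re (of_real ((norm x)\<^sup>2))"
    by (simp add: inner_eq_Re_cinner[symmetric] power2_norm_eq_inner)
  have "Im (cinner x x) = - Im (cinner x x)"
    using arg_cong[OF cinner_commute[of x x], of Im] by simp
  then show "Im (cinner x x) = Im (of_real ((norm x)\<^sup>2))" by simp
qed

text \<open>Reduces measurability and size estimates for \<open>cinner\<close> to those for the real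
  inner product.\<close>

lemma cinner_eq_inner:
  "cinner x y = of_real (inner x y) - \<i> * of_real (inner x (\<i> *\<^sub>C y))"
  by (rule complex_eqI) (simp_all add: inner_eq_Re_cinner cinner_scaleC_right)

lemma subspace_closure:
  fixes S :: "'k::real_normed_vector set"
  assumes "subspace S"
  shows "subspace (closure S)"
proof (rule subspaceI)
  show "0 \<in> closure S"
    using assms closure_subset subspace_0 by blast
next
  fix x y assume "x \<in> closure S" "y \<in> closure S"
  then obtain f g where "\<forall>n. f n \<in> S" "f \<longlonglongrightarrow> x" "\<forall>n. g n \<in> S" "g \<longlonglongrightarrow> y"
    unfolding closure_sequential by blast
  then show "x + y \<in> closure S"
    using assms unfolding closure_sequential
    by (intro exI[of _ "\<lambda>n. f n + g n"]) (auto intro: tendsto_add subspace_add)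
next
  fix c x assume "x \<in> closure S"
  then obtain f where "\<forall>n. f n \<in> S" "f \<longlonglongrightarrow> x"
    unfolding closure_sequential by blast
  then show "c *\<^sub>R x \<in> closure S"
    using assms unfolding closure_sequential
    by (intro exI[of _ "\<lambda>n. c *\<^sub>R f n"]) (auto intro: tendsto_scaleR subspace_scale)
qed

lemma inner_eq_0_on_closure_span:
  fixes x :: "'k::real_inner"
  assumes "\<And>y. y \<in> S \<Longrightarrow> inner y x = 0" and "y \<in> closure (span S)"
  shows "inner y x = 0"
proof -
  have "subspace {y. inner y x = 0}"
    by (auto simp: subspace_def inner_add_left)
  then have "span S \<subseteq> {y. inner y x = 0}"
    using assms(1) by (intro span_minimal) auto
  moreover have "closed {y. inner y x = 0}"
    by (intro closed_Collect_eq continuous_intros)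
  ultimately show ?thesis
    using assms(2) closure_minimal by blast
qed

text \<open>The bound extends to the closure by continuity and is then tested at \<open>w\<close>
  itself.\<close>

lemma norm_le_of_inner_bound:
  fixes w :: "'k::real_inner"
  assumes "w \<in> closure S" and "\<And>y. y \<in> S \<Longrightarrow> \<bar>inner y w\<bar> \<le> K * norm y" and "0 \<le> K"
  shows "norm w \<le> K"
proof -
  have "closed {y. \<bar>inner y w\<bar> \<le> K * norm y}"
    by (intro closed_Collect_le continuous_intros)
  moreover have "S \<subseteq> {y. \<bar>inner y w\<bar> \<le> K * norm y}" using assms(2) by blast
  ultimately have "\<bar>inner w w\<bar> \<le> K * norm w"
    using assms(1) closure_minimal by blast
  then have "norm w * norm w \<le> K * norm w"
    by (simp add: power2_norm_eq_inner[symmetric] power2_eq_square)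
  then show ?thesis
    using assms(3) by (cases "norm w = 0") (auto simp: mult_le_cancel_right)
qed

section \<open>Exponential vectors\<close>

lemma square_integrable_zero [simp]: "square_integrable (\<lambda>_. 0)"
  by (simp add: square_integrable_def set_integrable_def)

lemma square_integrable_restr:
  assumes "square_integrable f"
  shows "square_integrable (restr t f)"
  unfolding square_integrable_def
proof
  have f: "f \<in> borel_measurable lborel" "set_integrable lborel {0..} (\<lambda>s. (norm (f s))\<^sup>2)"
    using assms by (auto simp: square_integrable_def)
  show "restr t f \<in> borel_measurable lborel"
    unfolding restr_def by (intro borel_measurable_scaleR borel_measurable_indicator f(1)) simp
  have "integrable lborel (\<lambda>s. indicator {0..t} s *\<^sub>R (indicator {0..} s *\<^sub>R (norm (f s))\<^sup>2))"
    by (rule integrable_mult_indicator[OF _ f(2)[unfolded set_integrable_def]]) simp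
  also have "(\<lambda>s. indicator {0..t} s *\<^sub>R (indicator {0..} s *\<^sub>R (norm (f s))\<^sup>2))
      = (\<lambda>s. indicator {0..} s *\<^sub>R (norm (restr t f s))\<^sup>2)"
    by (auto simp: restr_def indicator_def)
  finally show "set_integrable lborel {0..} (\<lambda>s. (norm (restr t f s))\<^sup>2)"
    by (simp add: set_integrable_def)
qed

lemma restr_restr [simp]: "restr t (restr t f) = restr t f"
  by (auto simp: restr_def indicator_def)

lemma restr_zero [simp]: "restr t (\<lambda>_. 0) = (\<lambda>_. 0)"
  by (simp add: restr_def)

lemma cinner_restr: "cinner (f s) (restr t g s) = cinner (restr t f s) (restr t g s)"
  by (simp add: restr_def indicator_def)

lemma fock_inner:
  assumes "fock_tensor e" "square_integrable f" "square_integrable g"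
  shows "inner (e u f) (e v g) = Re (cinner u v * exp (LINT s:{0..}|lborel. cinner (f s) (g s)))"
  using assms unfolding fock_tensor_def inner_eq_Re_cinner by metis

lemma fock_total:
  assumes "fock_tensor e" and "\<And>u f. square_integrable f \<Longrightarrow> inner (e u f) x = 0"
  shows "x = 0"
proof -
  have "inner x x = 0"
    using assms inner_eq_0_on_closure_span[of "{e u f |u f. square_integrable f}" x x]
    unfolding fock_tensor_def by blast
  then show ?thesis by simp
qed

text \<open>For fixed \<open>f\<close> the map from \<open>u\<close> to \<open>e u f\<close>
  multiplies distances by a constant, as the kernel shows. The resulting continuity lets identities
  pass from a dense set of initial vectors to all of them.\<close>

lemma norm_exp_vector_diff:
  assumes "fock_tensor e" "square_integrable f"
  shows "(norm (e u f - e v f))\<^sup>2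
    = (norm (u - v))\<^sup>2 * exp (LINT s:{0..}|lborel. (norm (f s))\<^sup>2)"
proof -
  have "(LINT s:{0..}|lborel. cinner (f s) (f s)) = of_real (LINT s:{0..}|lborel. (norm (f s))\<^sup>2)"
    unfolding cinner_self by (rule set_integral_complex_of_real)
  then have i: "inner (e u f) (e v f) = inner u v * exp (LINT s:{0..}|lborel. (norm (f s))\<^sup>2)" for u v
    unfolding fock_inner[OF assms(1,2,2)] inner_eq_Re_cinner[of u v]
    by (simp add: exp_of_real)
  show ?thesis
    unfolding power2_norm_eq_inner inner_diff_left inner_diff_right i by (simp add: algebra_simps)
qed

lemma continuous_on_exp_vector:
  assumes "fock_tensor e" "square_integrable f"
  shows "continuous_on UNIV (\<lambda>u. e u f)"
proof -
  define E where "E = sqrt (exp (LINT s:{0..}|lborel. (norm (f s))\<^sup>2))"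
  have "dist (e u f) (e v f) = E * dist u v" for u v
  proof -
    have "norm (e u f - e v f) = sqrt ((norm (u - v))\<^sup>2 * exp (LINT s:{0..}|lborel. (norm (f s))\<^sup>2))"
      unfolding norm_exp_vector_diff[where u = u and v = v, OF assms, symmetric] by simp
    then show ?thesis by (simp add: dist_norm E_def real_sqrt_mult)
  qed
  then have "E-lipschitz_on UNIV (\<lambda>u. e u f)"
    by (intro lipschitz_onI) (simp_all add: E_def)
  then show ?thesis by (rule lipschitz_on_continuous_on)
qed

text \<open>These are the vectors in the product of the initial space, the Fock space up to time \<open>t\<close> and
  the vacuum after \<open>t\<close>, but stated weakly: in this form the property passes through the
  unbounded operators \<open>X j\<close>, which are symmetric but not continuous.\<close>

definition adapted_vector ::
  "('s::complex_hilbert_space \<Rightarrow> (real \<Rightarrow> complex ^ 'r) \<Rightarrow> 'h::complex_hilbert_space)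
     \<Rightarrow> real \<Rightarrow> 'h \<Rightarrow> bool" where
  "adapted_vector e t y \<longleftrightarrow>
     (\<forall>u f. square_integrable f \<longrightarrow> inner (e u f) y = inner (e u (restr t f)) y)"

section \<open>Adapted vectors and the operators that preserve them\<close>

text \<open>Let \<open>p\<close> be the projection of \<open>y\<close> onto the closed span. Neither
  \<open>y\<close> nor \<open>p\<close> distinguishes \<open>f\<close> from
  \<open>restr t f\<close>: the first by hypothesis, the second because the kernel with a truncated
  vector only sees \<open>f\<close> up to \<open>t\<close>. So \<open>y - p\<close>, being
  orthogonal to truncated exponential vectors, is orthogonal to all of them, and these are
  total.\<close>

lemma adapted_vector_imp_closure_span:
  assumes fock: "fock_tensor e" and y: "adapted_vector e t y"
  shows "y \<in> closure (span {e u (restr t f) |u f. square_integrable f})"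
proof -
  define K where "K = {e u (restr t f) |u f. square_integrable f}"
  obtain p where p: "p \<in> closure (span K)"
    "\<And>s. s \<in> closure (span K) \<Longrightarrow> inner s (y - p) = 0"
    using closed_subspace_projection[OF closed_closure subspace_closure[OF subspace_span], of K y]
    by blast
  have "inner (e u f) (y - p) = 0" if f: "square_integrable f" for u f
  proof -
    have "inner q (e u f - e u (restr t f)) = 0" if "q \<in> K" for q
      using that f by (auto simp: K_def inner_diff_right fock_inner[OF fock] square_integrable_restr
          inner_commute[of _ "e u f"] inner_commute[of _ "e u (restr t f)"] cinner_restr[of f])
    from inner_eq_0_on_closure_span[OF this p(1)]
    have "inner (e u f) p = inner (e u (restr t f)) p"
      by (simp add: inner_diff_right inner_commute)
    moreover have "inner (e u f) y = inner (e u (restr t f)) y"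
      using y f by (auto simp: adapted_vector_def)
    ultimately have "inner (e u f) (y - p) = inner (e u (restr t f)) (y - p)"
      by (simp add: inner_diff_right)
    moreover have "e u (restr t f) \<in> K" using f by (auto simp: K_def)
    then have "e u (restr t f) \<in> closure (span K)"
      by (intro subsetD[OF closure_subset] span_base)
    then have "inner (e u (restr t f)) (y - p) = 0" by (rule p(2))
    ultimately show ?thesis by simp
  qed
  then have "y - p = 0" using fock_total[OF fock] by blast
  then show ?thesis using p(1) by (simp add: K_def)
qed

lemma adapted_vector_inner_eq_0:
  assumes "fock_tensor e" "adapted_vector e t y"
    and "\<And>u f. square_integrable f \<Longrightarrow> inner (e u (restr t f)) z = 0"
  shows "inner y z = 0"
  by (rule inner_eq_0_on_closure_span[OF _ adapted_vector_imp_closure_span[OF assms(1,2)]])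
    (use assms(3) in auto)

lemma adapted_vector_vacuum:
  fixes e :: "'s::complex_hilbert_space \<Rightarrow> (real \<Rightarrow> complex ^ 'r) \<Rightarrow> 'h::complex_hilbert_space"
  assumes "adapted e t V"
  shows "adapted_vector e t (V (e u (\<lambda>_. 0)))"
  unfolding adapted_vector_def
proof (intro allI impI)
  fix v f assume f: "square_integrable (f :: real \<Rightarrow> complex ^ 'r)"
  have "cinner (e v f) (V (e u (\<lambda>_. 0))) = cinner (e v (restr t f)) (V (e u (restr t (\<lambda>_. 0))))
      * exp (LINT s:{t..}|lborel. cinner (f s) 0)"
    using assms f square_integrable_zero unfolding adapted_def by blast
  then show "inner (e v f) (V (e u (\<lambda>_. 0))) = inner (e v (restr t f)) (V (e u (\<lambda>_. 0)))"
    by (simp add: inner_eq_Re_cinner set_lebesgue_integral_def)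
qed

lemma unitary_inner: "unitary V \<Longrightarrow> inner (V x) (V y) = inner x y"
  by (simp add: unitary_def inner_eq_Re_cinner)

lemma unitary_inverse: "unitary V \<Longrightarrow> V (inv V y) = y"
  by (simp add: unitary_def surj_f_inv_f)

text \<open>Testing \<open>inv V y\<close> against \<open>e u f\<close> amounts to testing
  \<open>y\<close> against \<open>V (e u f)\<close>. As \<open>y\<close> lies in the closed span of
  truncated vectors, only matrix elements of \<open>V\<close> with a truncated left vector matter,
  and these do not see \<open>f\<close> after \<open>t\<close>.\<close>

lemma adapted_vector_unitary_inverse:
  fixes e :: "'s::complex_hilbert_space \<Rightarrow> (real \<Rightarrow> complex ^ 'r) \<Rightarrow> 'h::complex_hilbert_space"
  assumes fock: "fock_tensor e" and V: "adapted e t V" "unitary V"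
    and y: "adapted_vector e t y" and t: "0 \<le> t"
  shows "adapted_vector e t (inv V y)"
  unfolding adapted_vector_def
proof (intro allI impI)
  fix u f assume f: "square_integrable (f :: real \<Rightarrow> complex ^ 'r)"
  have 1: "inner (e v (restr t g)) (V (e u h)) = inner (e v (restr t g)) (V (e u (restr t h)))"
    if g: "square_integrable g" and h: "square_integrable h" for v g h
  proof -
    \<comment> \<open>The past and the future of \<open>t\<close> meet in the single point
      \<open>t\<close>, a null set, so the exponential factor is 1.\<close>
    have "(\<lambda>s. indicator {t..} s *\<^sub>R cinner (restr t g s) (h s))
        = (\<lambda>s. indicator {t} s *\<^sub>R cinner (g t) (h t))"
      using t by (auto simp: restr_def indicator_def)
    then have "(LINT s:{t..}|lborel. cinner (restr t g s) (h s)) = 0"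
      by (simp add: set_lebesgue_integral_def)
    moreover have "cinner (e v (restr t g)) (V (e u h)) =
        cinner (e v (restr t (restr t g))) (V (e u (restr t h)))
        * exp (LINT s:{t..}|lborel. cinner (restr t g s) (h s))"
      using V(1) square_integrable_restr[OF g] h unfolding adapted_def by blast
    ultimately show ?thesis by (simp add: inner_eq_Re_cinner)
  qed
  have "inner y (V (e u f) - V (e u (restr t f))) = 0"
    by (rule adapted_vector_inner_eq_0[OF fock y]) (simp add: inner_diff_right 1 f)
  then have "inner (V (e u f)) y = inner (V (e u (restr t f))) y"
    by (simp add: inner_diff_right inner_commute)
  moreover have "inner (V x) y = inner x (inv V y)" for x
    by (metis V(2) unitary_inner unitary_inverse)
  ultimately show "inner (e u f) (inv V y) = inner (e u (restr t f)) (inv V y)"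
    by simp
qed

text \<open>By symmetry \<open>X j\<close> moves to the exponential vector, where it changes only
  the initial vector \<open>v\<close> in \<open>D0\<close> and not the function. Density of
  \<open>D0\<close> and continuity in \<open>v\<close> remove the restriction on
  \<open>v\<close>.\<close>

lemma adapted_vector_system_operator:
  fixes e :: "'s::complex_hilbert_space \<Rightarrow> (real \<Rightarrow> complex ^ 'r) \<Rightarrow> 'h::complex_hilbert_space"
  assumes fock: "fock_tensor e" and acts: "acts_on_system e D X"
    and sym: "symmetric_on D (X j)" and y: "adapted_vector e t y" "y \<in> D"
  shows "adapted_vector e t (X j y)"
  unfolding adapted_vector_def
proof (intro allI impI)
  fix u f assume f: "square_integrable (f :: real \<Rightarrow> complex ^ 'r)"
  obtain D0 X0 where D0: "closure D0 = UNIV" "\<And>j. operator_on D0 (X0 j)"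
    "\<And>j u f. u \<in> D0 \<Longrightarrow> square_integrable f \<Longrightarrow> e u f \<in> D \<and> X j (e u f) = e (X0 j u) f"
    using acts unfolding acts_on_system_def by metis
  have 1: "inner (e v g) (X j y) = inner (e (X0 j v) g) y"
    if "v \<in> D0" "square_integrable g" for v g
    using sym D0(3)[OF that, of j] y(2) by (auto simp: adjoint_on_def inner_eq_Re_cinner)
  let ?S = "{v. inner (e v f) (X j y) = inner (e v (restr t f)) (X j y)}"
  have "continuous_on UNIV (\<lambda>v. inner (e v g) (X j y))" if "square_integrable g" for g
    by (rule continuous_on_inner[OF continuous_on_exp_vector[OF fock that] continuous_on_const])
  then have "closed ?S"
    using f square_integrable_restr by (intro closed_Collect_eq) auto
  moreover have "D0 \<subseteq> ?S"
  proof
    fix v assume v: "v \<in> D0"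
    have "inner (e (X0 j v) f) y = inner (e (X0 j v) (restr t f)) y"
      using y(1) f unfolding adapted_vector_def by blast
    then show "v \<in> ?S"
      by (simp add: 1[OF v f] 1[OF v square_integrable_restr[OF f]])
  qed
  ultimately have "closure D0 \<subseteq> ?S" by (rule closure_minimal[rotated])
  then show "inner (e u f) (X j y) = inner (e u (restr t f)) (X j y)"
    unfolding D0(1) by blast
qed

section \<open>Wiener increments on the vacuum\<close>

lemma set_integrable_cinner_const:
  fixes f :: "real \<Rightarrow> complex ^ 'r"
  assumes "square_integrable f"
  shows "set_integrable lborel {0..t} (\<lambda>r. cinner (f r) c)"
proof -
  have meas: "f \<in> borel_measurable lborel"
    and int: "set_integrable lborel {0..} (\<lambda>s. (norm (f s))\<^sup>2)"
    using assms by (auto simp: square_integrable_def)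
  have sq: "set_integrable lborel {0..t} (\<lambda>s. (norm (f s))\<^sup>2)"
    by (rule set_integrable_subset[OF int]) auto
  \<comment> \<open>Bounds the real and imaginary parts of the product with \<open>c\<close>
    together; on a bounded interval the constant \<open>k\<^sup>2\<close> is integrable.\<close>
  define k where "k = norm c + norm (\<i> *\<^sub>C c)"
  have "set_integrable lborel {0..t} (\<lambda>s. (norm (f s))\<^sup>2 + k\<^sup>2)"
    by (intro set_integral_add sq) (simp add: set_integrable_def integrable_real_indicator emeasure_lborel_Icc_eq)
  then show ?thesis
  proof (rule set_integrable_bound)
    show "set_borel_measurable lborel {0..t} (\<lambda>r. cinner (f r) c)"
      unfolding set_borel_measurable_def cinner_eq_inner using meas by measurable
    have "norm (cinner x c) \<le> norm ((norm x)\<^sup>2 + k\<^sup>2)" for x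
    proof -
      have "norm (cinner x c) \<le> \<bar>inner x c\<bar> + \<bar>inner x (\<i> *\<^sub>C c)\<bar>"
        using cmod_le[of "cinner x c"] unfolding cinner_eq_inner by simp
      also have "\<dots> \<le> norm x * k"
        using Cauchy_Schwarz_ineq2[of x c] Cauchy_Schwarz_ineq2[of x "\<i> *\<^sub>C c"]
        by (simp add: k_def distrib_left)
      also have "\<dots> \<le> (norm x)\<^sup>2 + k\<^sup>2"
        using sum_squares_bound[of "norm x" k] zero_le_power2[of "norm x"] zero_le_power2[of k] by linarith
      finally show ?thesis by simp
    qed
    then show "AE s in lborel. s \<in> {0..t} \<longrightarrow> norm (cinner (f s) c) \<le> norm ((norm (f s))\<^sup>2 + k\<^sup>2)"
      by simp
  qed
qed

text \<open>The creation of the constant function \<open>c\<close> on the interval from \<open>s\<close> to \<open>t\<close> is the derivative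
  at \<open>0\<close> of the exponential vectors of its multiples, and those have computable norms.\<close>

lemma norm_wiener_increment:
  assumes fock: "fock_tensor e" and st: "0 \<le> s" "s \<le> t"
    and w: "\<And>v f. square_integrable f \<Longrightarrow> inner (e v f) w
      = Re (((LINT r:{0..t}|lborel. cinner (f r) c) - (LINT r:{0..s}|lborel. cinner (f r) c))
          * cinner v u)"
  shows "(norm w)\<^sup>2 \<le> 2 * (norm c)\<^sup>2 * (t - s) * (norm u)\<^sup>2"
proof -
  \<comment> \<open>Starting at \<open>s\<close> exclusively makes the integrals over the two time
    intervals add up without overlap.\<close>
  define g where "g h r = h *\<^sub>R indicator {s<..t} r *\<^sub>R c" for h r :: real
  define G where "G = (norm c)\<^sup>2 * (t - s)"
  have G: "0 \<le> G" using st by (simp add: G_def)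
  have sq: "square_integrable (g h)" for h
    unfolding square_integrable_def
  proof
    show "g h \<in> borel_measurable lborel" unfolding g_def by measurable
    have "(\<lambda>r. indicator {0..} r *\<^sub>R (norm (g h r))\<^sup>2) = (\<lambda>r. indicator {s<..t} r *\<^sub>R (norm (h *\<^sub>R c))\<^sup>2)"
      using st by (auto simp: g_def indicator_def)
    then show "set_integrable lborel {0..} (\<lambda>r. (norm (g h r))\<^sup>2)"
      using st by (simp add: set_integrable_def integrable_real_indicator emeasure_lborel_Icc_eq)
  qed
  have gg: "(LINT r:{0..}|lborel. cinner (g h r) (g k r)) = of_real (h * k * G)" for h k
  proof -
    have "(\<lambda>r. indicator {0..} r *\<^sub>R cinner (g h r) (g k r))
        = (\<lambda>r. indicator {s<..t} r *\<^sub>R (complex_of_real (h * k * (norm c)\<^sup>2)))"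
      using st by (auto simp: g_def indicator_def cinner_scaleR_right cinner_scaleR_left cinner_self)
    then show ?thesis
      using st by (simp add: set_lebesgue_integral_def G_def scaleR_conv_of_real)
  qed
  define x where "x h = e u (g h)" for h
  have xx: "inner (x h) (x k) = (norm u)\<^sup>2 * exp (h * k * G)" for h k
    unfolding x_def fock_inner[OF fock sq sq] gg exp_of_real by (simp add: cinner_self)
  have xdiff: "(norm (x h - x 0))\<^sup>2 = (norm u)\<^sup>2 * (exp (h\<^sup>2 * G) - 1)" for h
    unfolding power2_norm_eq_inner inner_diff_left inner_diff_right xx
    by (simp add: power2_eq_square algebra_simps)
  \<comment> \<open>Only a weak derivative, tested against the dense span of exponential vectors, is
    needed to bound the norm of \<open>w\<close>.\<close>
  have deriv: "((\<lambda>h. inner y (x h)) has_real_derivative inner y w) (at 0)"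
    if "y \<in> span {e v f |v f. square_integrable f}" for y
    using that
  proof (rule span_induct)
    show "subspace {y. ((\<lambda>h. inner y (x h)) has_real_derivative inner y w) (at 0)}"
      by (auto simp: subspace_def inner_add_left intro!: derivative_eq_intros)
    fix y assume "y \<in> {e v f |v f. square_integrable f}"
    then obtain v f where y: "y = e v f" and f: "square_integrable f" by blast
    define Z where "Z = (LINT r:{s<..t}|lborel. cinner (f r) c)"
    have int: "set_integrable lborel {0..t} (\<lambda>r. cinner (f r) c)"
      by (rule set_integrable_cinner_const[OF f])
    have un: "{0..t} = {0..s} \<union> {s<..t}" using st by auto
    have "(LINT r:{0..t}|lborel. cinner (f r) c) = (LINT r:{0..s}|lborel. cinner (f r) c) + Z"
      unfolding un Z_def using st
      by (intro set_integral_Un set_integrable_subset[OF int]) auto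
    then have yw: "inner y w = Re (Z * cinner v u)"
      unfolding y w[OF f] by simp
    have "(LINT r:{0..}|lborel. cinner (f r) (g h r)) = of_real h * Z" for h
    proof -
      have "(\<lambda>r. indicator {0..} r *\<^sub>R cinner (f r) (g h r))
          = (\<lambda>r. of_real h * (indicator {s<..t} r *\<^sub>R cinner (f r) c))"
        using st by (auto simp: g_def indicator_def cinner_scaleR_right)
      then show ?thesis
        unfolding set_lebesgue_integral_def Z_def by (simp only: integral_mult_right_zero)
    qed
    then have yx: "inner y (x h) = Re (cinner v u * exp (of_real h * Z))" for h
      unfolding y x_def fock_inner[OF fock f sq] by simp
    have "((\<lambda>z. cinner v u * exp (z * Z)) has_field_derivative Z * cinner v u) (at (of_real 0))"
      by (auto intro!: derivative_eq_intros)
    then have "((\<lambda>h. cinner v u * exp (of_real h * Z)) has_vector_derivative Z * cinner v u) (at 0)"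
      by (rule has_vector_derivative_real_field)
    then have "((\<lambda>h. Re (cinner v u * exp (of_real h * Z))) has_vector_derivative Re (Z * cinner v u)) (at 0)"
      by (rule bounded_linear.has_vector_derivative[OF bounded_linear_Re])
    then show "((\<lambda>h. inner y (x h)) has_real_derivative inner y w) (at 0)"
      by (simp only: yx yw has_real_derivative_iff_has_vector_derivative)
  qed
  \<comment> \<open>A bound for the norms of the difference quotients: \<open>exp r - 1\<close> is
    at most \<open>2 * r\<close> for \<open>r\<close> between 0 and 1, here with
    \<open>r = h\<^sup>2 * G\<close>.\<close>
  define K where "K = sqrt (2 * G * (norm u)\<^sup>2)"
  have K0: "0 \<le> K" using G by (simp add: K_def)
  have "\<bar>inner y w\<bar> \<le> K * norm y" if y: "y \<in> span {e v f |v f. square_integrable f}" for y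
  proof (rule tendsto_upperbound)
    show "((\<lambda>h. \<bar>(inner y (x (0 + h)) - inner y (x 0)) / h\<bar>) \<longlongrightarrow> \<bar>inner y w\<bar>) (at 0)"
      using deriv[OF y] by (intro tendsto_rabs) (simp add: DERIV_def)
    have "((\<lambda>h. h\<^sup>2 * G) \<longlongrightarrow> 0\<^sup>2 * G) (at (0 :: real))"
      by (intro tendsto_intros)
    then have "\<forall>\<^sub>F h in at (0 :: real). h\<^sup>2 * G < 1"
      by (rule order_tendstoD(2)) simp
    moreover have "\<forall>\<^sub>F h in at (0 :: real). h \<noteq> 0"
      by (rule eventually_neq_at_within)
    ultimately show "\<forall>\<^sub>F h in at 0. \<bar>(inner y (x (0 + h)) - inner y (x 0)) / h\<bar> \<le> K * norm y"
    proof eventually_elim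
      case (elim h)
      have "exp (h\<^sup>2 * G) \<le> 1 + h\<^sup>2 * G + (h\<^sup>2 * G)\<^sup>2"
        using elim(1) G by (intro exp_bound) auto
      also have "(h\<^sup>2 * G)\<^sup>2 \<le> 1 * (h\<^sup>2 * G)"
        unfolding power2_eq_square[of "h\<^sup>2 * G"] using elim(1) G by (intro mult_right_mono) auto
      finally have "exp (h\<^sup>2 * G) - 1 \<le> 2 * h\<^sup>2 * G" by (simp add: algebra_simps)
      then have "(norm (x h - x 0))\<^sup>2 \<le> (norm u)\<^sup>2 * (2 * h\<^sup>2 * G)"
        unfolding xdiff by (intro mult_left_mono) auto
      also have "\<dots> = (K * \<bar>h\<bar>)\<^sup>2"
        using G by (simp add: K_def power_mult_distrib)
      finally have "norm (x h - x 0) \<le> K * \<bar>h\<bar>"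
        by (rule power2_le_imp_le) (simp add: K0)
      then have "norm y * norm (x h - x 0) \<le> norm y * (K * \<bar>h\<bar>)"
        by (rule mult_left_mono) simp
      then have "\<bar>inner y (x h - x 0)\<bar> \<le> norm y * (K * \<bar>h\<bar>)"
        using Cauchy_Schwarz_ineq2[of y "x h - x 0"] by linarith
      then show ?case
        using elim(2) by (simp add: inner_diff_right abs_divide divide_le_eq mult_ac)
    qed
  qed simp
  then have "norm w \<le> K"
    using fock K0 unfolding fock_tensor_def
    by (intro norm_le_of_inner_bound[of w "span {e v f |v f. square_integrable f}"]) auto
  then have "(norm w)\<^sup>2 \<le> K\<^sup>2" by (intro power_mono) auto
  also have "K\<^sup>2 = 2 * G * (norm u)\<^sup>2"
    using G by (simp add: K_def)
  finally show ?thesis by (simp add: G_def mult_ac)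
qed

text \<open>On the vacuum the annihilation part vanishes and only the creation part is left.\<close>

lemma wiener_vacuum_inner:
  assumes fock: "fock_tensor e" and f: "square_integrable f"
    and W: "\<And>u v f g. square_integrable f \<Longrightarrow> square_integrable g \<Longrightarrow> e v g \<in> D \<Longrightarrow>
      cinner (e u f) (Wt (e v g)) =
        ((LINT s:{0..t}|lborel. cinner c (g s)) + (LINT s:{0..t}|lborel. cinner (f s) c))
        * cinner (e u f) (e v g)"
    and D: "e u (\<lambda>_. 0) \<in> D"
  shows "inner (e v f) (Wt (e u (\<lambda>_. 0))) = Re ((LINT r:{0..t}|lborel. cinner (f r) c) * cinner v u)"
proof -
  have "cinner (e v f) (e u (\<lambda>_. 0)) = cinner v u"
    using fock f square_integrable_zero unfolding fock_tensor_def
    by (simp add: set_lebesgue_integral_def)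
  then show ?thesis
    using W[OF f square_integrable_zero D, of v]
    by (simp add: inner_eq_Re_cinner set_lebesgue_integral_def)
qed

lemma wiener_processes_vacuum:
  fixes e :: "'s::complex_hilbert_space \<Rightarrow> (real \<Rightarrow> complex ^ 'r) \<Rightarrow> 'h::complex_hilbert_space"
  assumes fock: "fock_tensor e" and W: "wiener_processes e D J W"
  shows "\<exists>L. \<forall>u k s t. e u (\<lambda>_. 0) \<in> D \<longrightarrow> 0 \<le> s \<longrightarrow> s \<le> t \<longrightarrow>
      (norm (W t k (e u (\<lambda>_. 0)) - W s k (e u (\<lambda>_. 0))))\<^sup>2 \<le> L * (t - s) * (norm u)\<^sup>2 \<and>
      (\<forall>y. adapted_vector e s y \<longrightarrow> inner y (W t k (e u (\<lambda>_. 0)) - W s k (e u (\<lambda>_. 0))) = 0)"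
proof -
  obtain c where c: "\<And>t k u v f g. 0 \<le> t \<Longrightarrow> square_integrable f \<Longrightarrow> square_integrable g \<Longrightarrow> e v g \<in> D \<Longrightarrow>
      cinner (e u f) (W t k (e v g)) =
        ((LINT s:{0..t}|lborel. cinner (c k) (g s)) + (LINT s:{0..t}|lborel. cinner (f s) (c k)))
        * cinner (e u f) (e v g)"
    using W unfolding wiener_processes_def by blast
  have w: "inner (e v f) (W t k (e u (\<lambda>_. 0)))
      = Re ((LINT r:{0..t}|lborel. cinner (f r) (c k)) * cinner v u)"
    if "e u (\<lambda>_. 0) \<in> D" "0 \<le> t" "square_integrable f" for u v t k f
    by (rule wiener_vacuum_inner[OF fock that(3) c[OF that(2)] that(1)])
  \<comment> \<open>The sum over the finitely many components gives one constant for every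
    \<open>k\<close>.\<close>
  define L where "L = 2 * (\<Sum>k\<in>UNIV. (norm (c k))\<^sup>2)"
  show ?thesis
  proof (intro exI allI impI conjI)
    fix u k and s t :: real assume u: "e u (\<lambda>_. 0) \<in> D" and st: "0 \<le> s" "s \<le> t"
    have t: "0 \<le> t" using st by simp
    have "(norm (W t k (e u (\<lambda>_. 0)) - W s k (e u (\<lambda>_. 0))))\<^sup>2 \<le> 2 * (norm (c k))\<^sup>2 * (t - s) * (norm u)\<^sup>2"
      by (rule norm_wiener_increment[OF fock st])
        (simp add: inner_diff_right w[OF u] t st left_diff_distrib)
    also have "(norm (c k))\<^sup>2 \<le> (\<Sum>k\<in>UNIV. (norm (c k))\<^sup>2)"
      by (rule member_le_sum) auto
    then have "2 * (norm (c k))\<^sup>2 * (t - s) * (norm u)\<^sup>2 \<le> L * (t - s) * (norm u)\<^sup>2"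
      using st by (intro mult_right_mono) (auto simp: L_def)
    finally show "(norm (W t k (e u (\<lambda>_. 0)) - W s k (e u (\<lambda>_. 0))))\<^sup>2 \<le> L * (t - s) * (norm u)\<^sup>2" .
    fix y assume y: "adapted_vector e s y"
    show "inner y (W t k (e u (\<lambda>_. 0)) - W s k (e u (\<lambda>_. 0))) = 0"
    proof (rule adapted_vector_inner_eq_0[OF fock y])
      fix v f assume f: "square_integrable (f :: real \<Rightarrow> complex ^ 'r)"
      \<comment> \<open>A function truncated at \<open>s\<close> has the same overlap with
        \<open>c k\<close> on both intervals, so the creation terms at \<open>t\<close> and
        \<open>s\<close> cancel.\<close>
      have "(\<lambda>r. indicator {0..t} r *\<^sub>R cinner (restr s f r) (c k))
          = (\<lambda>r. indicator {0..s} r *\<^sub>R cinner (restr s f r) (c k))"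
        using st by (auto simp: restr_def indicator_def)
      then show "inner (e v (restr s f)) (W t k (e u (\<lambda>_. 0)) - W s k (e u (\<lambda>_. 0))) = 0"
        by (simp add: inner_diff_right w[OF u] t st square_integrable_restr[OF f] set_lebesgue_integral_def)
    qed
  qed
qed

section \<open>Real matrices acting on vectors of Hilbert space elements\<close>

text \<open>The tensor product of \<open>N\<close> with the identity of the Hilbert space. Quadratic
  forms in the operators, evaluated at a vector, become inner products of such columns.\<close>

definition matrix_act :: "real ^ 'n ^ 'm \<Rightarrow> 'k::real_inner ^ 'n \<Rightarrow> 'k ^ 'm" where
  "matrix_act N x = (\<chi> j. \<Sum>k\<in>UNIV. (N $ j $ k) *\<^sub>R (x $ k))"

definition vec_comb :: "real ^ 'n \<Rightarrow> 'k::real_inner ^ 'n \<Rightarrow> 'k" where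
  "vec_comb u x = (\<Sum>k\<in>UNIV. (u $ k) *\<^sub>R (x $ k))"

lemma matrix_act_nth: "matrix_act N x $ j = vec_comb (N $ j) x"
  by (simp add: matrix_act_def vec_comb_def)

lemma linear_matrix_act: "linear (matrix_act N)"
  by (rule linearI)
    (simp_all add: matrix_act_def vec_eq_iff scaleR_add_right sum.distrib scaleR_sum_right mult.commute)

lemma bounded_linear_matrix_act: "bounded_linear (matrix_act N :: 'k::real_inner ^ 'n \<Rightarrow> 'k ^ 'm)"
proof (rule bounded_linear_intro)
  fix x y :: "'k ^ 'n" and r :: real
  show "matrix_act N (x + y) = matrix_act N x + matrix_act N y" "matrix_act N (r *\<^sub>R x) = r *\<^sub>R matrix_act N x"
    by (simp_all add: linear_add[OF linear_matrix_act] linear_scale[OF linear_matrix_act])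
  have "norm (matrix_act N x) \<le> (\<Sum>j\<in>UNIV. norm (matrix_act N x $ j))"
    unfolding norm_vec_def by (rule L2_set_le_sum) simp
  also have "\<dots> \<le> (\<Sum>j\<in>UNIV. \<Sum>k\<in>UNIV. \<bar>N $ j $ k\<bar> * norm x)"
  proof (rule sum_mono)
    fix j
    have "norm (matrix_act N x $ j) \<le> (\<Sum>k\<in>UNIV. norm ((N $ j $ k) *\<^sub>R (x $ k)))"
      by (simp only: matrix_act_def vec_lambda_beta norm_sum)
    also have "\<dots> \<le> (\<Sum>k\<in>UNIV. \<bar>N $ j $ k\<bar> * norm x)"
      by (intro sum_mono) (simp add: mult_left_mono Finite_Cartesian_Product.norm_nth_le)
    finally show "norm (matrix_act N x $ j) \<le> (\<Sum>k\<in>UNIV. \<bar>N $ j $ k\<bar> * norm x)" .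
  qed
  also have "\<dots> = norm x * (\<Sum>j\<in>UNIV. \<Sum>k\<in>UNIV. \<bar>N $ j $ k\<bar>)"
    by (simp add: sum_distrib_left mult.commute)
  finally show "norm (matrix_act N x) \<le> norm x * (\<Sum>j\<in>UNIV. \<Sum>k\<in>UNIV. \<bar>N $ j $ k\<bar>)" .
qed

lemma matrix_act_bound:
  obtains K where "0 < K" "\<And>x :: 'k::real_inner ^ 'n. norm (matrix_act N x) \<le> K * norm x"
  using bounded_linear.pos_bounded[OF bounded_linear_matrix_act, of N]
  by (metis mult.commute)

lemma matrix_act_mult: "matrix_act (M ** N) x = matrix_act M (matrix_act N x)"
proof -
  have "matrix_act (M ** N) x $ i = matrix_act M (matrix_act N x) $ i" for i
  proof -
    have "matrix_act (M ** N) x $ i = (\<Sum>k\<in>UNIV. \<Sum>j\<in>UNIV. (M $ i $ j * N $ j $ k) *\<^sub>R (x $ k))"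
      by (simp add: matrix_act_def matrix_matrix_mult_def scaleR_sum_left)
    also have "\<dots> = (\<Sum>j\<in>UNIV. \<Sum>k\<in>UNIV. (M $ i $ j * N $ j $ k) *\<^sub>R (x $ k))"
      by (rule sum.swap)
    finally show ?thesis
      by (simp add: matrix_act_def scaleR_sum_right)
  qed
  then show ?thesis by (simp add: vec_eq_iff)
qed

lemma matrix_act_add_matrix: "matrix_act (M + N) x = matrix_act M x + matrix_act N x"
  by (simp add: matrix_act_def vec_eq_iff scaleR_left_distrib sum.distrib)

lemma matrix_act_uminus_matrix: "matrix_act (- N) x = - matrix_act N x"
  by (simp add: matrix_act_def vec_eq_iff sum_negf)

lemma matrix_act_scaleR_matrix: "matrix_act (c *\<^sub>R N) x = c *\<^sub>R matrix_act N x"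
  by (simp add: matrix_act_def vec_eq_iff scaleR_sum_right)

lemma matrix_act_zero_matrix: "matrix_act 0 x = 0"
  by (simp add: matrix_act_def vec_eq_iff)

lemma matrix_act_mat: "matrix_act (mat c) x = c *\<^sub>R x"
  by (simp add: matrix_act_def vec_eq_iff mat_def if_distrib if_distribR cong: if_cong)

lemma inner_matrix_act_transpose: "inner x (matrix_act (transpose N) y) = inner (matrix_act N x) y"
proof -
  have "inner x (matrix_act (transpose N) y) = (\<Sum>j\<in>UNIV. \<Sum>k\<in>UNIV. N $ k $ j * inner (x $ j) (y $ k))"
    by (simp add: inner_vec_def matrix_act_def transpose_def inner_sum_right)
  also have "\<dots> = (\<Sum>k\<in>UNIV. \<Sum>j\<in>UNIV. N $ k $ j * inner (x $ j) (y $ k))"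
    by (rule sum.swap)
  also have "\<dots> = inner (matrix_act N x) y"
    by (simp add: inner_vec_def matrix_act_def inner_sum_left)
  finally show ?thesis .
qed

lemma inner_matrix_act_eq_0:
  assumes "\<And>j k. inner (x $ j) (y $ k) = 0"
  shows "inner (matrix_act M x) (matrix_act N y) = 0"
  unfolding inner_vec_def matrix_act_nth vec_comb_def by (simp add: inner_sum_left inner_sum_right assms)

text \<open>Semidefiniteness is known for columns of real numbers only; the Gram factor lifts it to
  columns of Hilbert space elements.\<close>

lemma inner_matrix_act_psd:
  fixes N :: "real ^ 'n ^ 'n"
  assumes "psd N"
  shows "0 \<le> inner x (matrix_act N x)"
proof -
  obtain Q :: "real ^ 'n ^ 'n" where "N = transpose Q ** Q" by (rule psd_eq_gram[OF assms])
  then have "inner x (matrix_act N x) = inner (matrix_act Q x) (matrix_act Q x)"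
    by (simp add: matrix_act_mult inner_matrix_act_transpose)
  then show ?thesis by simp
qed

text \<open>The rows of the matrix act as the test vectors \<open>u\<close> of
  superpositiveness.\<close>

lemma norm_matrix_act_sq: "(norm (matrix_act N x))\<^sup>2 = (\<Sum>i\<in>UNIV. (norm (vec_comb (N $ i) x))\<^sup>2)"
  by (simp add: power2_norm_eq_inner inner_vec_def matrix_act_nth)

lemma vec_comb_linear_image:
  assumes "linear V"
  shows "vec_comb u (\<chi> j. V (x $ j)) = V (vec_comb u x)"
  unfolding vec_comb_def by (simp add: linear_sum[OF assms] linear_scale[OF assms])

lemma has_integral_vec:
  fixes f :: "real \<Rightarrow> 'k::real_inner ^ 'n"
  assumes "\<And>j. ((\<lambda>s. f s $ j) has_integral (I $ j)) S"
  shows "(f has_integral I) S"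
proof -
  let ?E = "\<lambda>j (x :: 'k). (axis j x :: 'k ^ 'n)"
  have E: "bounded_linear (?E j)" for j
  proof (rule bounded_linear_intro)
    show "norm (?E j x) \<le> norm x * 1" for x
      by (simp add: norm_eq_sqrt_inner inner_axis_axis)
  qed (simp_all add: axis_def vec_eq_iff)
  have ex: "x = (\<Sum>j\<in>UNIV. ?E j (x $ j))" for x :: "'k ^ 'n"
    by (simp add: vec_eq_iff axis_def if_distrib if_distribR cong: if_cong)
  have "((\<lambda>s. \<Sum>j\<in>UNIV. ?E j (f s $ j)) has_integral (\<Sum>j\<in>UNIV. ?E j (I $ j))) S"
    using has_integral_linear[OF assms E] by (intro has_integral_sum) (auto simp: o_def)
  then show ?thesis unfolding ex[symmetric] .
qed

text \<open>Here \<open>\<parallel>Q x\<parallel>\<^sup>2\<close> is the Lyapunov function \<open>x\<^sup>T \<Pi> x\<close>. The cross term with \<open>z\<close> is split by the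
  Cauchy inequality with weight \<open>\<mu>\<^sub>1\<close>, which is what \<open>\<Gamma>\<^sub>0\<close> pays for.\<close>

lemma admissible_params_imp_dissipation:
  fixes A :: "real ^ 'n ^ 'n"
  assumes "(\<mu>1, \<Gamma>s) \<in> admissible_params A"
  shows "\<exists>(Q' :: real ^ 'n ^ 'n) (Q :: real ^ 'n ^ 'n) \<gamma> C K. Q' ** Q = mat 1 \<and> 0 < \<gamma> \<and>
    (\<forall>x z :: 'k::real_inner ^ 'n.
      (\<forall>u. (norm (vec_comb u z))\<^sup>2 \<le> \<mu>1 * (\<Sum>\<Gamma>\<leftarrow>\<Gamma>s. (norm (vec_comb u (matrix_act \<Gamma> x)))\<^sup>2) + \<mu>0 * (norm u)\<^sup>2) \<longrightarrow>
      2 * inner (matrix_act Q x) (matrix_act Q (matrix_act A x + z)) \<le> C - \<gamma> * (norm (matrix_act Q x))\<^sup>2 \<and>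
      norm (matrix_act Q (matrix_act A x + z)) \<le> K * (norm (matrix_act Q x) + 1))"
proof -
  obtain P \<gamma> where \<mu>1: "0 < \<mu>1" and P: "pos_def P" and \<gamma>: "0 < \<gamma>"
    and N: "psd (- (transpose A ** P + P ** A
       + (\<Sum>\<Gamma>\<leftarrow>mat (sqrt \<mu>1) # \<Gamma>s. transpose \<Gamma> ** P ** \<Gamma>) + \<gamma> *\<^sub>R P))"
    using assms unfolding admissible_params_def by blast
  have psdP: "psd P"
    using P unfolding pos_def_def psd_def by (metis inner_zero_left less_eq_real_def)
  obtain Q :: "real ^ 'n ^ 'n" where Q: "P = transpose Q ** Q" by (rule psd_eq_gram[OF psdP])
  \<comment> \<open>Definiteness of \<open>P\<close> makes \<open>Q\<close> injective. Its left
    inverse recovers \<open>x\<close> from \<open>matrix_act Q x\<close>, both for the growth bound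
    on the drift and for the return to the second moments.\<close>
  have "x = 0" if "Q *v x = 0" for x
  proof (rule ccontr)
    assume "x \<noteq> 0"
    then have "0 < inner x (P *v x)" using P by (simp add: pos_def_def)
    moreover have "P *v x = 0"
      unfolding Q using that by (simp add: matrix_vector_mul_assoc[symmetric])
    ultimately show False by simp
  qed
  then have "\<exists>Q'. Q' ** Q = mat 1"
    unfolding matrix_left_invertible_ker by blast
  then obtain Q' :: "real ^ 'n ^ 'n" where Q': "Q' ** Q = mat 1" by blast
  obtain KA where KA: "0 < KA" "\<And>x :: 'k ^ 'n. norm (matrix_act (Q ** A ** Q') x) \<le> KA * norm x"
    using matrix_act_bound[of "Q ** A ** Q'"] by blast
  \<comment> \<open>The squared Frobenius norm of \<open>Q\<close>, which appears when the term
    \<open>\<mu>0 * (norm u)\<^sup>2\<close> is summed over its rows.\<close>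
  define c where "c = (\<Sum>i\<in>UNIV. (norm (Q $ i))\<^sup>2)"
  have c0: "0 \<le> c" by (simp add: c_def sum_nonneg)
  define K where "K = KA + sqrt (\<mu>1 * (2 * KA)) + sqrt (\<bar>\<mu>0\<bar> * c)"
  have main: "2 * inner (matrix_act Q x) (matrix_act Q (matrix_act A x + z)) \<le> \<mu>0 * c / \<mu>1 - \<gamma> * (norm (matrix_act Q x))\<^sup>2 \<and>
      norm (matrix_act Q (matrix_act A x + z)) \<le> K * (norm (matrix_act Q x) + 1)"
    if z: "\<And>u. (norm (vec_comb u z))\<^sup>2 \<le> \<mu>1 * (\<Sum>\<Gamma>\<leftarrow>\<Gamma>s. (norm (vec_comb u (matrix_act \<Gamma> x)))\<^sup>2) + \<mu>0 * (norm u)\<^sup>2"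
    for x z :: "'k ^ 'n"
  proof -
    let ?a = "matrix_act Q x"
    define b where "b = matrix_act Q (matrix_act A x)"
    define s where "s = (\<Sum>\<Gamma>\<leftarrow>\<Gamma>s. (norm (matrix_act Q (matrix_act \<Gamma> x)))\<^sup>2)"
    have gram: "inner x (matrix_act (transpose \<Gamma> ** P ** \<Gamma>) x) = (norm (matrix_act Q (matrix_act \<Gamma> x)))\<^sup>2" for \<Gamma> :: "real ^ 'n ^ 'n"
      by (simp add: matrix_act_mult Q inner_matrix_act_transpose matrix_mul_assoc[symmetric] power2_norm_eq_inner)
    have sum: "inner x (matrix_act (\<Sum>\<Gamma>\<leftarrow>L. transpose \<Gamma> ** P ** \<Gamma>) x) = (\<Sum>\<Gamma>\<leftarrow>L. (norm (matrix_act Q (matrix_act \<Gamma> x)))\<^sup>2)" for L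
      by (induction L) (simp_all add: matrix_act_zero_matrix matrix_act_add_matrix inner_add_right gram)
    have ineq: "0 \<le> - (inner x (matrix_act (transpose A ** P) x) + inner x (matrix_act (P ** A) x)
        + (\<Sum>\<Gamma>\<leftarrow>mat (sqrt \<mu>1) # \<Gamma>s. (norm (matrix_act Q (matrix_act \<Gamma> x)))\<^sup>2) + \<gamma> * inner x (matrix_act P x))"
      using inner_matrix_act_psd[OF N, of x]
      unfolding matrix_act_uminus_matrix matrix_act_add_matrix matrix_act_scaleR_matrix inner_add_right inner_minus_right
        inner_scaleR_right sum .
    have eqs: "inner x (matrix_act (transpose A ** P) x) = inner ?a b" "inner x (matrix_act (P ** A) x) = inner ?a b"
      "inner x (matrix_act P x) = (norm ?a)\<^sup>2"
      unfolding Q b_def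
      by (simp_all add: matrix_act_mult inner_matrix_act_transpose inner_commute power2_norm_eq_inner)
    have eq_s: "(\<Sum>\<Gamma>\<leftarrow>mat (sqrt \<mu>1) # \<Gamma>s. (norm (matrix_act Q (matrix_act \<Gamma> x)))\<^sup>2) = \<mu>1 * (norm ?a)\<^sup>2 + s"
      using \<mu>1 by (simp add: s_def matrix_act_mat linear_scale[OF linear_matrix_act] power_mult_distrib)
    have lyap: "2 * inner ?a b + \<mu>1 * (norm ?a)\<^sup>2 + s + \<gamma> * (norm ?a)\<^sup>2 \<le> 0"
      using ineq unfolding eqs eq_s by linarith
    \<comment> \<open>The hypothesis is used with each row of \<open>Q\<close> as \<open>u\<close>,
      and the results are added.\<close>
    have az: "(norm (matrix_act Q z))\<^sup>2 \<le> \<mu>1 * s + \<mu>0 * c"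
    proof -
      have "(norm (matrix_act Q z))\<^sup>2 \<le> (\<Sum>i\<in>UNIV. \<mu>1 * (\<Sum>\<Gamma>\<leftarrow>\<Gamma>s. (norm (vec_comb (Q $ i) (matrix_act \<Gamma> x)))\<^sup>2) + \<mu>0 * (norm (Q $ i))\<^sup>2)"
        unfolding norm_matrix_act_sq by (intro sum_mono z)
      also have "\<dots> = \<mu>1 * (\<Sum>i\<in>UNIV. \<Sum>\<Gamma>\<leftarrow>\<Gamma>s. (norm (vec_comb (Q $ i) (matrix_act \<Gamma> x)))\<^sup>2) + \<mu>0 * c"
        by (simp add: sum.distrib sum_distrib_left c_def)
      also have "(\<Sum>i\<in>UNIV. \<Sum>\<Gamma>\<leftarrow>L. (norm (vec_comb (Q $ i) (matrix_act \<Gamma> x)))\<^sup>2) = (\<Sum>\<Gamma>\<leftarrow>L. (norm (matrix_act Q (matrix_act \<Gamma> x)))\<^sup>2)" for L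
        by (induction L) (simp_all add: sum.distrib norm_matrix_act_sq)
      finally show ?thesis by (simp only: s_def)
    qed
    have sum_b: "matrix_act Q (matrix_act A x + z) = b + matrix_act Q z"
      by (simp add: b_def linear_add[OF linear_matrix_act])
    have cross: "2 * inner ?a (matrix_act Q z) \<le> \<mu>1 * (norm ?a)\<^sup>2 + (norm (matrix_act Q z))\<^sup>2 / \<mu>1"
    proof -
      have "0 \<le> (norm (\<mu>1 *\<^sub>R ?a - matrix_act Q z))\<^sup>2" by simp
      also have "\<dots> = \<mu>1 * (\<mu>1 * (norm ?a)\<^sup>2) - \<mu>1 * (2 * inner ?a (matrix_act Q z)) + (norm (matrix_act Q z))\<^sup>2"
        unfolding power2_norm_eq_inner inner_diff_left inner_diff_right
        by (simp add: inner_commute[of "matrix_act Q z" ?a])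
      finally have "\<mu>1 * (2 * inner ?a (matrix_act Q z)) \<le> \<mu>1 * (\<mu>1 * (norm ?a)\<^sup>2 + (norm (matrix_act Q z))\<^sup>2 / \<mu>1)"
        using \<mu>1 by (simp add: distrib_left)
      then show ?thesis using \<mu>1 by (simp only: mult_le_cancel_left_pos)
    qed
    have "(norm (matrix_act Q z))\<^sup>2 / \<mu>1 \<le> (\<mu>1 * s + \<mu>0 * c) / \<mu>1"
      using az \<mu>1 by (intro divide_right_mono) auto
    also have "\<dots> = s + \<mu>0 * c / \<mu>1" using \<mu>1 by (simp add: add_divide_distrib)
    finally have 1: "2 * inner ?a (b + matrix_act Q z) \<le> \<mu>0 * c / \<mu>1 - \<gamma> * (norm ?a)\<^sup>2"
      using cross lyap by (simp add: inner_add_right)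
    have nb: "norm b \<le> KA * norm ?a"
    proof -
      have "matrix_act Q' (matrix_act Q x) = x" using Q' by (simp add: matrix_act_mult[symmetric] matrix_act_mat)
      then have "b = matrix_act (Q ** A ** Q') ?a" by (simp add: b_def matrix_act_mult)
      then show ?thesis using KA(2) by metis
    qed
    \<comment> \<open>The Lyapunov inequality also bounds \<open>s\<close> itself: after dropping
      its nonnegative terms, \<open>s\<close> is controlled by the product of \<open>?a\<close> and
      \<open>b\<close>. This yields the linear growth of the perturbation.\<close>
    have "0 \<le> \<mu>1 * (norm ?a)\<^sup>2" "0 \<le> \<gamma> * (norm ?a)\<^sup>2" using \<mu>1 \<gamma> by auto
    then have "s \<le> 2 * \<bar>inner ?a b\<bar>" using lyap by linarith
    also have "\<dots> \<le> 2 * (norm ?a * norm b)"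
      using Cauchy_Schwarz_ineq2[of ?a b] by simp
    also have "\<dots> \<le> 2 * (norm ?a * (KA * norm ?a))"
      using nb by (intro mult_left_mono) auto
    also have "\<dots> = 2 * KA * (norm ?a)\<^sup>2" by (simp add: power2_eq_square)
    finally have "\<mu>1 * s \<le> \<mu>1 * (2 * KA * (norm ?a)\<^sup>2)" using \<mu>1 by (intro mult_left_mono) auto
    moreover have "\<mu>0 * c \<le> \<bar>\<mu>0\<bar> * c" using c0 by (intro mult_right_mono) auto
    ultimately have "(norm (matrix_act Q z))\<^sup>2 \<le> \<mu>1 * (2 * KA) * (norm ?a)\<^sup>2 + \<bar>\<mu>0\<bar> * c"
      using az by (simp add: mult.assoc)
    then have "norm (matrix_act Q z) \<le> sqrt (\<mu>1 * (2 * KA) * (norm ?a)\<^sup>2 + \<bar>\<mu>0\<bar> * c)"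
      by (rule real_le_rsqrt)
    also have "\<dots> \<le> sqrt (\<mu>1 * (2 * KA) * (norm ?a)\<^sup>2) + sqrt (\<bar>\<mu>0\<bar> * c)"
      using \<mu>1 KA(1) c0 by (intro sqrt_add_le_add_sqrt) auto
    also have "\<dots> = sqrt (\<mu>1 * (2 * KA)) * norm ?a + sqrt (\<bar>\<mu>0\<bar> * c)"
      by (simp add: real_sqrt_mult)
    finally have 2: "norm (matrix_act Q z) \<le> sqrt (\<mu>1 * (2 * KA)) * norm ?a + sqrt (\<bar>\<mu>0\<bar> * c)" .
    have "norm (b + matrix_act Q z) \<le> KA * norm ?a + (sqrt (\<mu>1 * (2 * KA)) * norm ?a + sqrt (\<bar>\<mu>0\<bar> * c))"
      using norm_triangle_ineq[of b "matrix_act Q z"] nb 2 by linarith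
    also have "\<dots> \<le> K * (norm ?a + 1)"
    proof -
      have "0 \<le> sqrt (\<bar>\<mu>0\<bar> * c) * norm ?a" "0 \<le> KA" "0 \<le> sqrt (\<mu>1 * (2 * KA))"
        using c0 KA(1) \<mu>1 by auto
      then show ?thesis by (simp add: K_def distrib_left distrib_right)
    qed
    finally have 3: "norm (b + matrix_act Q z) \<le> K * (norm ?a + 1)" .
    show ?thesis unfolding sum_b using 1 3 by blast
  qed
  show ?thesis
    by (rule exI[of _ Q'], rule exI[of _ Q], rule exI[of _ \<gamma>], rule exI[of _ "\<mu>0 * c / \<mu>1"],
        rule exI[of _ K], intro conjI[OF Q' conjI[OF \<gamma>]] allI impI main) blast
qed

section \<open>Perturbed evolutions\<close>

lemma csubspace_diff: "csubspace D \<Longrightarrow> x \<in> D \<Longrightarrow> y \<in> D \<Longrightarrow> x - y \<in> D"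
  unfolding csubspace_def by (metis scaleC_minus_one add_uminus_conv_diff)

lemma symmetric_on_inner:
  "symmetric_on D L \<Longrightarrow> x \<in> D \<Longrightarrow> y \<in> D \<Longrightarrow> inner x (L y) = inner (L x) y"
  by (simp add: adjoint_on_def inner_eq_Re_cinner)

lemma i_commutator_symmetric:
  assumes D: "csubspace D" and H: "operator_on D H" "symmetric_on D H"
    and L: "operator_on D L" "symmetric_on D L"
  shows "symmetric_on D (i_commutator H L)" "x \<in> D \<Longrightarrow> i_commutator H L x \<in> D"
proof -
  have inv: "H x \<in> D" "L x \<in> D" if "x \<in> D" for x
    using H(1) L(1) that by (auto simp: operator_on_def)
  show "symmetric_on D (i_commutator H L)"
    unfolding adjoint_on_def
  proof (intro ballI)
    fix x y assume xy: "x \<in> D" "y \<in> D"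
    have "cinner x (H (L y)) = cinner (L (H x)) y" "cinner x (L (H y)) = cinner (H (L x)) y"
      using H(2) L(2) xy inv by (simp_all add: adjoint_on_def)
    then show "cinner x (i_commutator H L y) = cinner (i_commutator H L x) y"
      by (simp add: i_commutator_def cinner_scaleC_right cinner_scaleC_left cinner_diff_right
          cinner_diff_left algebra_simps)
  qed
  show "i_commutator H L x \<in> D" if "x \<in> D"
  proof -
    have "H (L x) - L (H x) \<in> D"
      using that by (intro csubspace_diff[OF D] inv)
    then show ?thesis
      using D by (simp add: i_commutator_def csubspace_def)
  qed
qed

lemma norm_comb_sq:
  "(norm (vec_comb u y))\<^sup>2 = (\<Sum>j\<in>UNIV. \<Sum>k\<in>UNIV. u $ j * u $ k * inner (y $ j) (y $ k))"
  unfolding power2_norm_eq_inner vec_comb_def inner_sum_left inner_sum_right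
  by (simp add: sum_distrib_left mult.assoc) (intro sum.cong refl, simp add: inner_commute)

text \<open>The operator inequality is evaluated at \<open>\<phi>\<close>. All operators are
  symmetric and leave \<open>D\<close> invariant, so one factor of each product moves to the left
  and the double sums become squared norms.\<close>

lemma superpos_le_imp_comb_bound:
  fixes X :: "'n::finite \<Rightarrow> 'h \<Rightarrow> 'h::complex_hilbert_space"
  assumes D: "csubspace D"
    and X: "\<And>j. operator_on D (X j)" "\<And>j. symmetric_on D (X j)"
    and H: "operator_on D H" "symmetric_on D H"
    and le: "superpos_le D (op_outer (perturbation_vector X H))
      (\<lambda>j k x. \<mu>1 *\<^sub>R (\<Sum>\<Gamma>\<leftarrow>\<Gamma>s. op_congruence \<Gamma> (op_outer X) j k x) + op_scalar \<mu>0 j k x)"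
    and \<phi>: "\<phi> \<in> D"
  shows "(norm (vec_comb u (\<chi> j. perturbation_vector X H j \<phi>)))\<^sup>2
    \<le> \<mu>1 * (\<Sum>\<Gamma>\<leftarrow>\<Gamma>s. (norm (vec_comb u (matrix_act \<Gamma> (\<chi> j. X j \<phi>))))\<^sup>2) + \<mu>0 * (norm u)\<^sup>2 * (norm \<phi>)\<^sup>2"
proof -
  define q where "q T = (\<Sum>j\<in>UNIV. \<Sum>k\<in>UNIV. u $ j * u $ k * inner \<phi> (T j k))" for T :: "'n \<Rightarrow> 'n \<Rightarrow> 'h"
  have q_diff: "q (\<lambda>j k. S j k - T j k) = q S - q T"
    and q_add: "q (\<lambda>j k. S j k + T j k) = q S + q T"
    and q_scale: "q (\<lambda>j k. c *\<^sub>R S j k) = c * q S" for S T c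
    by (simp_all add: q_def inner_simps sum_subtractf sum.distrib sum_distrib_left algebra_simps)
  have q_list: "q (\<lambda>j k. \<Sum>\<Gamma>\<leftarrow>L. T \<Gamma> j k) = (\<Sum>\<Gamma>\<leftarrow>L. q (T \<Gamma>))" for L and T :: "real ^ 'n ^ 'n \<Rightarrow> _"
    by (induction L) (simp_all add: q_add, simp add: q_def)
  let ?Z = "perturbation_vector X H"
  let ?N = "\<lambda>j k x. \<mu>1 *\<^sub>R (\<Sum>\<Gamma>\<leftarrow>\<Gamma>s. op_congruence \<Gamma> (op_outer X) j k x) + op_scalar \<mu>0 j k x"
  \<comment> \<open>Real coefficients, since the test vectors will be rows of a real matrix.\<close>
  define u' :: "complex ^ 'n" where "u' = (\<chi> j. of_real (u $ j))"
  have congr: "q (\<lambda>j k. op_congruence \<Gamma> (op_outer X) j k \<phi>) = (norm (vec_comb u (matrix_act \<Gamma> (\<chi> j. X j \<phi>))))\<^sup>2" for \<Gamma>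
  proof -
    have "inner \<phi> (X a (X b \<phi>)) = inner (X a \<phi>) (X b \<phi>)" for a b
      using X \<phi> by (intro symmetric_on_inner[of D]) (auto simp: operator_on_def)
    then have "inner \<phi> (op_congruence \<Gamma> (op_outer X) j k \<phi>)
        = inner (matrix_act \<Gamma> (\<chi> j. X j \<phi>) $ j) (matrix_act \<Gamma> (\<chi> j. X j \<phi>) $ k)" for j k
      by (simp add: op_congruence_def op_outer_def inner_sum_right inner_sum_left matrix_act_def
          sum_distrib_left mult.assoc) (subst sum.swap, simp add: mult.left_commute)
    then show ?thesis by (simp add: q_def norm_comb_sq)
  qed
  have "cinner \<phi> (\<Sum>j\<in>UNIV. \<Sum>k\<in>UNIV. (cnj (u' $ j) * u' $ k) *\<^sub>C (?N j k \<phi> - op_outer ?Z j k \<phi>)) \<in> \<real>\<^sub>\<ge>\<^sub>0"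
    using le \<phi> unfolding superpos_le_def superpositive_def by blast
  then have "0 \<le> inner \<phi> (\<Sum>j\<in>UNIV. \<Sum>k\<in>UNIV. (cnj (u' $ j) * u' $ k) *\<^sub>C (?N j k \<phi> - op_outer ?Z j k \<phi>))"
    by (simp add: inner_eq_Re_cinner complex_nonneg_Reals_iff)
  also have "\<dots> = q (\<lambda>j k. ?N j k \<phi> - op_outer ?Z j k \<phi>)"
    by (simp add: q_def u'_def inner_sum_right flip: of_real_mult scaleR_scaleC)
  also have "\<dots> = \<mu>1 * (\<Sum>\<Gamma>\<leftarrow>\<Gamma>s. q (\<lambda>j k. op_congruence \<Gamma> (op_outer X) j k \<phi>))
      + q (\<lambda>j k. op_scalar \<mu>0 j k \<phi>) - q (\<lambda>j k. op_outer ?Z j k \<phi>)"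
    by (simp only: q_diff q_add q_scale q_list)
  also have "q (\<lambda>j k. op_outer ?Z j k \<phi>) = (norm (vec_comb u (\<chi> j. ?Z j \<phi>)))\<^sup>2"
  proof -
    have "inner \<phi> (?Z j (?Z k \<phi>)) = inner (?Z j \<phi>) (?Z k \<phi>)" for j k
      unfolding perturbation_vector_def
      by (intro symmetric_on_inner[of D] i_commutator_symmetric D H X \<phi>)
    then show ?thesis by (simp add: q_def op_outer_def norm_comb_sq)
  qed
  also have "q (\<lambda>j k. op_scalar \<mu>0 j k \<phi>) = \<mu>0 * (norm u)\<^sup>2 * (norm \<phi>)\<^sup>2"
  proof -
    have "q (\<lambda>j k. op_scalar \<mu>0 j k \<phi>) = (\<Sum>j\<in>UNIV. u $ j * u $ j * (\<mu>0 * (norm \<phi>)\<^sup>2))"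
      unfolding q_def
    proof (rule sum.cong[OF refl])
      fix j
      have "(\<Sum>k\<in>UNIV. u $ j * u $ k * inner \<phi> (op_scalar \<mu>0 j k \<phi>))
          = (\<Sum>k\<in>UNIV. if k = j then u $ j * u $ j * (\<mu>0 * (norm \<phi>)\<^sup>2) else 0)"
        by (rule sum.cong) (auto simp: op_scalar_def power2_norm_eq_inner)
      then show "(\<Sum>k\<in>UNIV. u $ j * u $ k * inner \<phi> (op_scalar \<mu>0 j k \<phi>)) = u $ j * u $ j * (\<mu>0 * (norm \<phi>)\<^sup>2)"
        by simp
    qed
    also have "\<dots> = (norm u)\<^sup>2 * (\<mu>0 * (norm \<phi>)\<^sup>2)"
      by (simp add: power2_norm_eq_inner[of u] inner_vec_def sum_distrib_right)
    finally show ?thesis by simp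
  qed
  finally show ?thesis unfolding congr by linarith
qed

section \<open>Heisenberg evolution of the second moments\<close>

lemma unitary_inverse_linear:
  fixes V :: "'h::complex_hilbert_space \<Rightarrow> 'h"
  assumes V: "unitary V"
  shows "linear (inv V)" "inv V (a *\<^sub>C x) = a *\<^sub>C inv V x" "cinner x (inv V y) = cinner (V x) y"
    "norm (inv V x) = norm x" "norm (V x) = norm x"
proof -
  have nV: "norm (V x) = norm x" for x
    by (simp add: norm_eq_sqrt_inner unitary_inner[OF V])
  have lin: "V (x + y) = V x + V y" "V (a *\<^sub>C x) = a *\<^sub>C V x" for x y a
    using V by (auto simp: unitary_def clinear_on_def)
  have inj: "inv V (V x) = x" for x
  proof -
    have "V (x - y) = V x - V y" for x y
      using lin(1)[of x "(-1) *\<^sub>C y"] lin(2)[of "-1" y] by (simp add: scaleC_minus_one)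
    then have "inj V" using nV by (metis injI eq_iff_diff_eq_0 norm_eq_zero)
    then show ?thesis by simp
  qed
  have surj: "V (inv V x) = x" for x by (rule unitary_inverse[OF V])
  have C: "inv V (a *\<^sub>C x) = a *\<^sub>C inv V x" for a x
    using inj[of "a *\<^sub>C inv V x"] by (simp add: lin surj)
  show "linear (inv V)"
  proof (rule linearI)
    show "inv V (x + y) = inv V x + inv V y" for x y
      using inj[of "inv V x + inv V y"] by (simp add: lin surj)
    show "inv V (r *\<^sub>R x) = r *\<^sub>R inv V x" for r x
      by (simp add: scaleR_scaleC C)
  qed
  show "inv V (a *\<^sub>C x) = a *\<^sub>C inv V x" by (rule C)
  show "cinner x (inv V y) = cinner (V x) y"
    using V surj[of y] unfolding unitary_def by metis
  show "norm (inv V x) = norm x" "norm (V x) = norm x"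
    using nV[of "inv V x"] nV surj by auto
qed

text \<open>Conjugation commutes with commutators, so \<open>Z\<close> at time \<open>t\<close> is
  the conjugate of the initial one and inherits its bound.\<close>

lemma heis_i_commutator:
  fixes U :: "real \<Rightarrow> 'h::complex_hilbert_space \<Rightarrow> 'h"
  assumes V: "unitary (U t)"
  shows "i_commutator (heis U t H) (heis U t L) x = inv (U t) (i_commutator H L (U t x))"
  by (simp add: i_commutator_def heis_def unitary_inverse[OF V] unitary_inverse_linear(2)[OF V]
      linear_diff[OF unitary_inverse_linear(1)[OF V]])

lemma norm_exp_vector_vacuum:
  assumes "fock_tensor e"
  shows "norm (e u (\<lambda>_. 0)) = norm u"
proof -
  have "inner (e u (\<lambda>_. 0)) (e u (\<lambda>_. 0)) = inner u u"
    unfolding fock_inner[OF assms square_integrable_zero square_integrable_zero]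
    by (simp add: set_lebesgue_integral_def inner_eq_Re_cinner)
  then show ?thesis by (simp add: norm_eq_sqrt_inner)
qed

lemma system_variables_symmetric:
  assumes "system_variables D \<Theta> X"
  shows "symmetric_on D (X j)"
proof -
  have "lin_comb (axis j 1) X = X j"
    by (simp add: lin_comb_def axis_def fun_eq_iff if_distrib if_distribR cong: if_cong)
  then show ?thesis
    using assms unfolding system_variables_def ess_selfadjoint_on_def by metis
qed

lemma perturbed_evolution_vector_bound:
  fixes A :: "real ^ 'n ^ 'n" and B :: "real ^ 'm ^ 'n"
    and e :: "'s::complex_hilbert_space \<Rightarrow> (real \<Rightarrow> complex ^ 'r) \<Rightarrow> 'h::complex_hilbert_space"
  assumes fock: "fock_tensor e"
    and X: "system_variables D \<Theta> X" "acts_on_system e D X"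
    and W: "wiener_processes e D J W"
    and H: "H \<in> perturbation_class D A X"
    and U: "perturbed_evolution e D A B X W H U"
  shows "\<exists>c1 c2 c3. 0 < c1 \<and> 0 < c2 \<and> 0 \<le> c3 \<and>
    (\<forall>u t. e u (\<lambda>_. 0) \<in> D \<longrightarrow> norm u = 1 \<longrightarrow> 0 \<le> t \<longrightarrow>
      (\<Sum>j\<in>UNIV. (norm (heis U t (X j) (e u (\<lambda>_. 0))))\<^sup>2)
      \<le> c1 * exp (- c2 * t) * (\<Sum>j\<in>UNIV. (norm (heis U 0 (X j) (e u (\<lambda>_. 0))))\<^sup>2) + c3)"
proof -
  have D: "csubspace D" and opX: "\<And>j. operator_on D (X j)" and symX: "\<And>j. symmetric_on D (X j)"
    using system_variables_symmetric[OF X(1)] X(1) by (auto simp: system_variables_def)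
  obtain \<mu>1 \<Gamma>s \<mu>0 where adm: "(\<mu>1, \<Gamma>s) \<in> admissible_params A"
    and le: "superpos_le D (op_outer (perturbation_vector X H))
      (\<lambda>j k x. \<mu>1 *\<^sub>R (\<Sum>\<Gamma>\<leftarrow>\<Gamma>s. op_congruence \<Gamma> (op_outer X) j k x) + op_scalar \<mu>0 j k x)"
    using H unfolding perturbation_class_def by blast
  have opH: "operator_on D H" and symH: "symmetric_on D H"
    using H by (auto simp: perturbation_class_def weyl_quantization_def)
  obtain Q' Q :: "real ^ 'n ^ 'n" and \<gamma> C K where Q': "Q' ** Q = mat 1" and \<gamma>: "0 < \<gamma>"
    and diss: "\<forall>x z :: 'h ^ 'n.
      (\<forall>u. (norm (vec_comb u z))\<^sup>2 \<le> \<mu>1 * (\<Sum>\<Gamma>\<leftarrow>\<Gamma>s. (norm (vec_comb u (matrix_act \<Gamma> x)))\<^sup>2) + \<mu>0 * (norm u)\<^sup>2) \<longrightarrow>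
      2 * inner (matrix_act Q x) (matrix_act Q (matrix_act A x + z)) \<le> C - \<gamma> * (norm (matrix_act Q x))\<^sup>2 \<and>
      norm (matrix_act Q (matrix_act A x + z)) \<le> K * (norm (matrix_act Q x) + 1)"
    using admissible_params_imp_dissipation[OF adm, where 'k = 'h and ?\<mu>0.0 = \<mu>0] by (elim exE conjE)
  obtain L where L:
    "\<And>u k s t. e u (\<lambda>_. 0) \<in> D \<Longrightarrow> 0 \<le> s \<Longrightarrow> s \<le> t \<Longrightarrow>
      (norm (W t k (e u (\<lambda>_. 0)) - W s k (e u (\<lambda>_. 0))))\<^sup>2 \<le> L * (t - s) * (norm u)\<^sup>2"
    "\<And>u k s t y. e u (\<lambda>_. 0) \<in> D \<Longrightarrow> 0 \<le> s \<Longrightarrow> s \<le> t \<Longrightarrow> adapted_vector e s y \<Longrightarrow>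
      inner y (W t k (e u (\<lambda>_. 0)) - W s k (e u (\<lambda>_. 0))) = 0"
    using wiener_processes_vacuum[OF fock W] by blast
  obtain K1 where K1: "0 < K1" "\<And>x :: 'h ^ 'n. norm (matrix_act Q x) \<le> K1 * norm x"
    using matrix_act_bound[of Q] by blast
  obtain K2 where K2: "0 < K2" "\<And>x :: 'h ^ 'n. norm (matrix_act Q' x) \<le> K2 * norm x"
    using matrix_act_bound[of Q'] by blast
  obtain K3 where K3: "0 < K3" "\<And>x :: 'h ^ 'm. norm (matrix_act (Q ** B) x) \<le> K3 * norm x"
    using matrix_act_bound[of "Q ** B"] by blast
  \<comment> \<open>\<open>K3\<close> bounds the matrix \<open>Q ** B\<close>, and each of the
    \<open>CARD('m)\<close> noise components contributes \<open>L\<close>.\<close>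
  define L' where "L' = K3\<^sup>2 * (real CARD('m) * L)"
  have bound: "(\<Sum>j\<in>UNIV. (norm (heis U t (X j) (e u (\<lambda>_. 0))))\<^sup>2)
      \<le> K2\<^sup>2 * K1\<^sup>2 * exp (- \<gamma> * t) * (\<Sum>j\<in>UNIV. (norm (heis U 0 (X j) (e u (\<lambda>_. 0))))\<^sup>2)
        + K2\<^sup>2 * (\<bar>C + 2 * L'\<bar> / \<gamma>)"
    if \<psi>D: "e u (\<lambda>_. 0) \<in> D" and nu: "norm u = 1" and t: "0 \<le> t" for u t
  proof -
    define \<psi> where "\<psi> = e u (\<lambda>_. 0)"
    have uni: "unitary (U r)" and ad: "adapted e r (U r)" and UD: "U r \<psi> \<in> D" if "0 \<le> r" for r
      using U that \<psi>D unfolding perturbed_evolution_def \<psi>_def by blast+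
    define x where "x r = (\<chi> j. heis U r (X j) \<psi>)" for r
    define z where "z r = (\<chi> j. i_commutator (heis U r H) (heis U r (X j)) \<psi>)" for r
    define w where "w r = (\<chi> k. W r k \<psi>)" for r
    define a where "a r = matrix_act Q (x r)" for r
    have x_eq: "x r = (\<chi> j. inv (U r) ((\<chi> j. X j (U r \<psi>)) $ j))" for r
      by (simp add: x_def heis_def)
    have z_eq: "z r = (\<chi> j. inv (U r) ((\<chi> j. perturbation_vector X H j (U r \<psi>)) $ j))" if "0 \<le> r" for r
      by (simp add: z_def perturbation_vector_def heis_i_commutator[of U r, OF uni[OF that]])
    have hyp: "(norm (vec_comb v (z r)))\<^sup>2 \<le> \<mu>1 * (\<Sum>\<Gamma>\<leftarrow>\<Gamma>s. (norm (vec_comb v (matrix_act \<Gamma> (x r))))\<^sup>2) + \<mu>0 * (norm v)\<^sup>2"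
      if r: "0 \<le> r" for v r
    proof -
      note V = unitary_inverse_linear[OF uni[OF r]]
      have "matrix_act \<Gamma> (x r) = (\<chi> j. inv (U r) (matrix_act \<Gamma> (\<chi> j. X j (U r \<psi>)) $ j))" for \<Gamma> :: "real ^ 'n ^ 'n"
      proof -
        have "matrix_act \<Gamma> (x r) $ i = inv (U r) (matrix_act \<Gamma> (\<chi> j. X j (U r \<psi>)) $ i)" for i
          by (simp only: x_eq matrix_act_nth vec_comb_linear_image[OF V(1)])
        then show ?thesis by (simp add: vec_eq_iff)
      qed
      then have 1: "norm (vec_comb v (matrix_act \<Gamma> (x r))) = norm (vec_comb v (matrix_act \<Gamma> (\<chi> j. X j (U r \<psi>))))" for \<Gamma> :: "real ^ 'n ^ 'n"
        by (simp only: vec_comb_linear_image[OF V(1)] V(4))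
      have 2: "norm (vec_comb v (z r)) = norm (vec_comb v (\<chi> j. perturbation_vector X H j (U r \<psi>)))"
        unfolding z_eq[OF r] vec_comb_linear_image[OF V(1)] V(4) ..
      \<comment> \<open>Normalization removes the factor \<open>(norm \<phi>)\<^sup>2\<close> from
        the term with \<open>\<mu>0\<close>.\<close>
      have "norm (U r \<psi>) = 1"
        unfolding V(5) \<psi>_def norm_exp_vector_vacuum[OF fock] by (rule nu)
      then show ?thesis
        using superpos_le_imp_comb_bound[OF D opX symX opH symH le UD[OF r], of v]
        unfolding 1 2 by simp
    qed
    have "(norm (a t))\<^sup>2 \<le> exp (- \<gamma> * t) * (norm (a 0))\<^sup>2 + \<bar>C + 2 * L'\<bar> / \<gamma>"
    proof (rule adapted_process_mean_square_bound[where b = "\<lambda>r. matrix_act Q (matrix_act A (x r) + z r)"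
          and w = "\<lambda>r. matrix_act (Q ** B) (w r)" and K = K, OF _ _ _ _ _ \<gamma> t])
      fix r :: real assume r: "0 \<le> r"
      show "norm (matrix_act Q (matrix_act A (x r) + z r)) \<le> K * (norm (a r) + 1)"
        "2 * inner (a r) (matrix_act Q (matrix_act A (x r) + z r)) \<le> C - \<gamma> * (norm (a r))\<^sup>2"
        using diss[rule_format, OF hyp[OF r]] unfolding a_def by auto
      have "((\<lambda>s. matrix_act A (x s) + z s) has_integral (x r - x 0 - matrix_act B (w r))) {0..r}"
      proof (rule has_integral_vec)
        fix j
        have "((\<lambda>s. (\<Sum>k\<in>UNIV. (A $ j $ k) *\<^sub>R heis U s (X k) \<psi>)
              + i_commutator (heis U s H) (heis U s (X j)) \<psi>)
         has_integral
         (heis U r (X j) \<psi> - heis U 0 (X j) \<psi> - (\<Sum>k\<in>UNIV. (B $ j $ k) *\<^sub>R W r k \<psi>))) {0..r}"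
          using U r \<psi>D unfolding perturbed_evolution_def \<psi>_def by blast
        then show "((\<lambda>s. (matrix_act A (x s) + z s) $ j) has_integral (x r - x 0 - matrix_act B (w r)) $ j) {0..r}"
          by (simp add: matrix_act_def x_def z_def w_def)
      qed
      from has_integral_linear[OF this bounded_linear_matrix_act[of Q]]
      show "((\<lambda>r. matrix_act Q (matrix_act A (x r) + z r)) has_integral a r - a 0 - matrix_act (Q ** B) (w r)) {0..r}"
        by (simp add: o_def a_def matrix_act_mult linear_diff[OF linear_matrix_act])
    next
      fix s r :: real assume sr: "0 \<le> s" "s \<le> r"
      have dw: "matrix_act (Q ** B) (w r) - matrix_act (Q ** B) (w s) = matrix_act (Q ** B) (w r - w s)"
        by (simp add: linear_diff[OF linear_matrix_act])
      have "adapted_vector e s (x s $ j)" for j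
      \<comment> \<open>Adaptedness is followed through the three factors of
        \<open>heis U s (X j)\<close> in their order of action.\<close>
      proof -
        have "adapted_vector e s (U s \<psi>)"
          unfolding \<psi>_def by (rule adapted_vector_vacuum[OF ad[OF sr(1)]])
        then have "adapted_vector e s (X j (U s \<psi>))"
          by (rule adapted_vector_system_operator[OF fock X(2) symX _ UD[OF sr(1)]])
        then show ?thesis
          unfolding x_eq vec_lambda_beta
          by (rule adapted_vector_unitary_inverse[OF fock ad[OF sr(1)] uni[OF sr(1)] _ sr(1)])
      qed
      then have "inner (x s $ j) ((w r - w s) $ k) = 0" for j k
        using L(2)[OF \<psi>D sr] by (simp add: w_def \<psi>_def)
      then show "inner (a s) (matrix_act (Q ** B) (w r) - matrix_act (Q ** B) (w s)) = 0"
        unfolding dw a_def by (rule inner_matrix_act_eq_0)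
      have "(norm (matrix_act (Q ** B) (w r - w s)))\<^sup>2 \<le> (K3 * norm (w r - w s))\<^sup>2"
        by (intro power_mono K3) auto
      also have "\<dots> = K3\<^sup>2 * (\<Sum>k\<in>UNIV. (norm ((w r - w s) $ k))\<^sup>2)"
        by (simp add: power_mult_distrib power2_norm_eq_inner inner_vec_def)
      also have "(\<Sum>k\<in>UNIV. (norm ((w r - w s) $ k))\<^sup>2) \<le> (\<Sum>k\<in>(UNIV :: 'm set). L * (r - s))"
        using L(1)[OF \<psi>D sr] by (intro sum_mono) (simp add: w_def \<psi>_def nu)
      then have "K3\<^sup>2 * (\<Sum>k\<in>UNIV. (norm ((w r - w s) $ k))\<^sup>2) \<le> L' * (r - s)"
        by (simp add: L'_def mult.assoc mult_left_mono)
      finally show "(norm (matrix_act (Q ** B) (w r) - matrix_act (Q ** B) (w s)))\<^sup>2 \<le> L' * (r - s)"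
        unfolding dw .
    qed
    then have "K2\<^sup>2 * (norm (a t))\<^sup>2
        \<le> K2\<^sup>2 * (exp (- \<gamma> * t) * (norm (a 0))\<^sup>2 + \<bar>C + 2 * L'\<bar> / \<gamma>)"
      by (intro mult_left_mono) auto
    also have "\<dots> = K2\<^sup>2 * exp (- \<gamma> * t) * (norm (a 0))\<^sup>2 + K2\<^sup>2 * (\<bar>C + 2 * L'\<bar> / \<gamma>)"
      by (simp add: distrib_left)
    also have "(norm (a 0))\<^sup>2 \<le> (K1 * norm (x 0))\<^sup>2"
      unfolding a_def by (intro power_mono K1) auto
    then have "K2\<^sup>2 * exp (- \<gamma> * t) * (norm (a 0))\<^sup>2 \<le> K2\<^sup>2 * exp (- \<gamma> * t) * (K1 * norm (x 0))\<^sup>2"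
      by (intro mult_left_mono) auto
    also have "\<dots> = K2\<^sup>2 * K1\<^sup>2 * exp (- \<gamma> * t) * (norm (x 0))\<^sup>2"
      by (simp add: power_mult_distrib)
    finally have fin: "K2\<^sup>2 * (norm (a t))\<^sup>2
        \<le> K2\<^sup>2 * K1\<^sup>2 * exp (- \<gamma> * t) * (norm (x 0))\<^sup>2 + K2\<^sup>2 * (\<bar>C + 2 * L'\<bar> / \<gamma>)"
      by simp
    have "matrix_act Q' (a t) = x t"
      unfolding a_def matrix_act_mult[symmetric] Q' by (simp add: matrix_act_mat)
    then have "norm (x t) \<le> K2 * norm (a t)" using K2(2) by metis
    then have "(norm (x t))\<^sup>2 \<le> (K2 * norm (a t))\<^sup>2" by (rule power_mono) simp
    then have "(norm (x t))\<^sup>2 \<le> K2\<^sup>2 * (norm (a t))\<^sup>2" by (simp add: power_mult_distrib)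
    with fin have "(norm (x t))\<^sup>2 \<le> K2\<^sup>2 * K1\<^sup>2 * exp (- \<gamma> * t) * (norm (x 0))\<^sup>2 + K2\<^sup>2 * (\<bar>C + 2 * L'\<bar> / \<gamma>)"
      by simp
    moreover have "(norm (x r))\<^sup>2 = (\<Sum>j\<in>UNIV. (norm (heis U r (X j) \<psi>))\<^sup>2)" for r
      by (simp add: x_def power2_norm_eq_inner inner_vec_def)
    ultimately show ?thesis by (simp only: \<psi>_def)
  qed
  show ?thesis
  proof (rule exI[of _ "K2\<^sup>2 * K1\<^sup>2"], rule exI[of _ \<gamma>], rule exI[of _ "K2\<^sup>2 * (\<bar>C + 2 * L'\<bar> / \<gamma>)"],
      intro conjI allI impI)
    show "0 < K2\<^sup>2 * K1\<^sup>2" "0 < \<gamma>" "0 \<le> K2\<^sup>2 * (\<bar>C + 2 * L'\<bar> / \<gamma>)"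
      using K1(1) K2(1) \<gamma> by auto
  qed (rule bound)
qed

section \<open>Averaging over the initial state\<close>

lemma expectation_term_square_sum:
  fixes e :: "'s::complex_hilbert_space \<Rightarrow> (real \<Rightarrow> complex ^ 'r) \<Rightarrow> 'h::complex_hilbert_space"
  assumes X: "\<And>j. operator_on D (X j)" "\<And>j. symmetric_on D (X j)"
    and U: "unitary (U t)" "U t ` D = D"
    and \<psi>: "p i \<noteq> 0 \<Longrightarrow> e (u i) (\<lambda>_. 0) \<in> D"
  shows "expectation_term e p u (square_sum X U t) i
    = of_real (p i * (\<Sum>j\<in>UNIV. (norm (heis U t (X j) (e (u i) (\<lambda>_. 0))))\<^sup>2))"
proof (cases "p i = 0")
  case False
  define \<psi> where "\<psi> = e (u i) (\<lambda>_. 0)"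
  have \<phi>: "U t \<psi> \<in> D" using \<psi>[OF False] U(2) unfolding \<psi>_def by blast
  note V = unitary_inverse_linear[OF U(1)]
  have "cinner \<psi> (heis U t (X j) (heis U t (X j) \<psi>)) = of_real ((norm (heis U t (X j) \<psi>))\<^sup>2)" for j
  proof -
    have "cinner \<psi> (heis U t (X j) (heis U t (X j) \<psi>)) = cinner (U t \<psi>) (X j (X j (U t \<psi>)))"
      by (simp add: heis_def V(3) unitary_inverse[OF U(1)])
    also have "\<dots> = cinner (X j (U t \<psi>)) (X j (U t \<psi>))"
      using X(1)[of j] X(2)[of j] \<phi> unfolding adjoint_on_def operator_on_def by blast
    also have "\<dots> = of_real ((norm (heis U t (X j) \<psi>))\<^sup>2)"
      by (simp add: cinner_self heis_def V(4))
    finally show ?thesis .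
  qed
  then show ?thesis
    by (simp add: expectation_term_def square_sum_def cinner_sum_right \<psi>_def)
qed (simp add: expectation_term_def)

lemma perturbed_evolution_mean_square_stable:
  fixes A :: "real ^ 'n ^ 'n" and B :: "real ^ 'm ^ 'n"
    and e :: "'s::complex_hilbert_space \<Rightarrow> (real \<Rightarrow> complex ^ 'r) \<Rightarrow> 'h::complex_hilbert_space"
  assumes fock: "fock_tensor e"
    and X: "system_variables D \<Theta> X" "acts_on_system e D X"
    and W: "wiener_processes e D J W"
    and H: "H \<in> perturbation_class D A X"
    and U: "perturbed_evolution e D A B X W H U"
  shows "mean_square_stable e D X U"
proof -
  have opX: "\<And>j. operator_on D (X j)" and symX: "\<And>j. symmetric_on D (X j)"
    using system_variables_symmetric[OF X(1)] X(1) by (auto simp: system_variables_def)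
  obtain c1 c2 c3 where c: "0 < c1" "0 < c2" "0 \<le> c3"
    and bound: "\<And>u t. e u (\<lambda>_. 0) \<in> D \<Longrightarrow> norm u = 1 \<Longrightarrow> 0 \<le> t \<Longrightarrow>
      (\<Sum>j\<in>UNIV. (norm (heis U t (X j) (e u (\<lambda>_. 0))))\<^sup>2)
      \<le> c1 * exp (- c2 * t) * (\<Sum>j\<in>UNIV. (norm (heis U 0 (X j) (e u (\<lambda>_. 0))))\<^sup>2) + c3"
    using perturbed_evolution_vector_bound[OF assms] by blast
  have "has_expectation e p u (square_sum X U t) \<and>
      Re (expectation e p u (square_sum X U t))
      \<le> c1 * exp (- c2 * t) * Re (expectation e p u (square_sum X U 0)) + c3"
    if init: "initial_state e D p u" and he: "has_expectation e p u (square_sum X U 0)" and t: "0 \<le> t"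
    for p u t
  proof -
    have p: "\<And>i. 0 \<le> p i" "p sums 1" "\<And>i. p i \<noteq> 0 \<Longrightarrow> e (u i) (\<lambda>_. 0) \<in> D"
      "\<And>i. p i \<noteq> 0 \<Longrightarrow> cinner (u i) (u i) = 1"
      using init unfolding initial_state_def by metis+
    have nu: "norm (u i) = 1" if "p i \<noteq> 0" for i
      using p(4)[OF that] unfolding cinner_self of_real_eq_1_iff
      by (metis abs_norm_cancel abs_square_eq_1)
    define S where "S r i = p i * (\<Sum>j\<in>UNIV. (norm (heis U r (X j) (e (u i) (\<lambda>_. 0))))\<^sup>2)" for r i
    have S0: "0 \<le> S r i" for r i
      by (simp add: S_def p(1) sum_nonneg)
    have ev: "unitary (U r)" "U r ` D = D" if "0 \<le> r" for r
      using U that unfolding perturbed_evolution_def by blast+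
    have tm: "expectation_term e p u (square_sum X U r) = (\<lambda>i. of_real (S r i))" if "0 \<le> r" for r
      unfolding S_def by (intro ext expectation_term_square_sum[where D = D] opX symX ev[OF that] p(3))
    have he_iff: "has_expectation e p u (square_sum X U r) \<longleftrightarrow> summable (S r)" if "0 \<le> r" for r
      by (simp add: has_expectation_def tm[OF that] S0)
    have ex: "Re (expectation e p u (square_sum X U r)) = (\<Sum>i. S r i)" if "0 \<le> r" "summable (S r)" for r
      by (simp add: expectation_def tm[OF that(1)] suminf_of_real[OF that(2), symmetric])
    have sum0: "summable (S 0)" using he he_iff[of 0] by simp
    \<comment> \<open>An eigenvector of weight zero may lie outside \<open>D\<close>, where no bound
      is available; both sides then vanish.\<close>
    have le: "S t i \<le> c1 * exp (- c2 * t) * S 0 i + c3 * p i" for i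
    proof (cases "p i = 0")
      case False
      have "S t i \<le> p i * (c1 * exp (- c2 * t) * (\<Sum>j\<in>UNIV. (norm (heis U 0 (X j) (e (u i) (\<lambda>_. 0))))\<^sup>2) + c3)"
        unfolding S_def by (intro mult_left_mono bound p(3) nu False t p(1))
      then show ?thesis by (simp add: S_def algebra_simps)
    qed (simp add: S_def)
    \<comment> \<open>The weights add up to 1, so averaging leaves \<open>c3\<close> unchanged. The
      same series dominates \<open>S t\<close>, which proves that the second moments at time
      \<open>t\<close> are finite.\<close>
    have R: "(\<lambda>i. c1 * exp (- c2 * t) * S 0 i + c3 * p i) sums (c1 * exp (- c2 * t) * (\<Sum>i. S 0 i) + c3 * 1)"
      by (intro sums_add sums_mult summable_sums sum0 p(2))
    have sumt: "summable (S t)"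
      by (rule summable_comparison_test'[OF sums_summable[OF R], of 0]) (use S0 le in simp)
    have "(\<Sum>i. S t i) \<le> c1 * exp (- c2 * t) * (\<Sum>i. S 0 i) + c3 * 1"
      unfolding sums_unique[OF R] by (rule suminf_le[OF le sumt sums_summable[OF R]])
    then show ?thesis
      by (simp add: he_iff t sumt ex sum0)
  qed
  then show ?thesis
    using c unfolding mean_square_stable_def by blast
qed

theorem theorem1:
  fixes \<Theta> R :: "real ^ 'n ^ 'n"
    and J :: "real ^ 'm ^ 'm"
    and M :: "real ^ 'n ^ 'm"
    and e :: "'s::complex_hilbert_space \<Rightarrow> (real \<Rightarrow> complex ^ 'r) \<Rightarrow> 'h::complex_hilbert_space"
    and D :: "'h set"
    and X :: "'n \<Rightarrow> 'h \<Rightarrow> 'h"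
    and W :: "real \<Rightarrow> 'm \<Rightarrow> 'h \<Rightarrow> 'h"
  assumes "transpose \<Theta> = - \<Theta>" and "invertible \<Theta>"
    and "transpose R = R"
    and "transpose J = - J" and "cpsd (ito_table J)"
    and "fock_tensor e"
    and "system_variables D \<Theta> X" and "acts_on_system e D X"
    and "wiener_processes e D J W"
    and "hurwitz (drift_matrix \<Theta> R J M)"
  shows "admissible_params (drift_matrix \<Theta> R J M) \<noteq> {} \<and>
    (\<forall>H1 \<in> perturbation_class D (drift_matrix \<Theta> R J M) X. \<forall>U.
       perturbed_evolution e D (drift_matrix \<Theta> R J M) (noise_matrix \<Theta> M) X W H1 U \<longrightarrow>
       mean_square_stable e D X U)"
  using hurwitz_imp_admissible_params_nonempty[OF assms(10)]
    perturbed_evolution_mean_square_stable[OF assms(6-9)] by blast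

end
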